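(* Let $\varphi$ be a homeomorphism of a generalized Jordan domain $U$ onto a domain $\Omega\subset\widehat{\mathbb{C}}$. Then $\varphi$ has a continuous extension $\overline{\varphi}:\overline{U}\rightarrow\overline{\Omega}$ if and only if the conditions below are both satisfied: (1) the boundary $\partial\Omega$ is a Peano compactum; (2) the oscillations of $\varphi$ satisfy $\liminf_{r\rightarrow 0}\sigma_r(z_0)=0$ for all $z_0\in\partial U$. Suppose that the continuous extension $\overline{\varphi}:\overline{U}\rightarrow\overline{\Omega}$ exists. Then $\overline{\varphi}$ is a monotone map if and only if $\Omega$ is also a generalized Jordan domain. Consequently, if further no arc on $\partial U$ of positive diameter is sent by $\overline{\varphi}$ to a single point of $\partial\Omega$, then $\overline{\varphi}$ is actually a homeomorphism.
   Context: A domain is a connected open subset of the extended complex plane $\widehat{\mathbb{C}}$; closures and boundaries are taken in $\widehat{\mathbb{C}}$. A generalized Jordan domain is a domain $U\subset\widehat{\mathbb{C}}$ every component of whose boundary is a point or a Jordan curve, such that at most countably many boundary components are Jordan curves and the diameters of these form a null sequence (a finite sequence, or an infinite one converging to zero). A Peano continuum is the image of $[0,1]$ under a continuous map. A Peano compactum is a compact metrisable space each of whose components is a Peano continuum (possibly a single point), such that for any $C>0$ at most finitely many of the components have diameter $>C$. For $r>0$ and $z_0\in\partial U$, $C_r(z_0)$ denotes the circle centered at $z_0$ with radius $r$, and the oscillation $\sigma_r(z_0)$ of $\varphi$ at $C_r(z_0)\cap U$ is the supremum of the spherical distance from $\varphi(x)$ to $\varphi(y)$ over all $x,y\in C_r(z_0)\cap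 U$. A monotone map is a continuous map between compact metric spaces with connected point inverses.
   Formalization: The final "Consequently" is stated with the added assumption that Ω is a generalized Jordan domain (equivalently, that the extension is monotone); without it the claim fails, e.g. for z+1/z mapping the unit disc onto the sphere minus [-2,2]. *)

theory Defs
  imports "HOL-Analysis.Analysis"
begin

section \<open>The extended complex plane with the spherical metric\<close>

datatype ext_complex = Fin complex | Infty

text \<open>Stereographic projection from the north pole onto the unit sphere in
  \<open>complex \<times> real\<close>, i.e. in three-dimensional Euclidean space.\<close>

fun stereo :: "ext_complex \<Rightarrow> complex \<times> real" where
  "stereo (Fin z) =
     ((2 / (1 + (cmod z)\<^sup>2)) *\<^sub>R z, ((cmod z)\<^sup>2 - 1) / ((cmod z)\<^sup>2 + 1))"
| "stereo Infty = (0, 1)"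

lemma inner_stereo_self: "stereo x \<bullet> stereo x = 1"
proof (cases x)
  case (Fin z)
  define a where "a = (cmod z)\<^sup>2"
  have a: "a \<ge> 0" by (simp add: a_def)
  have zz: "z \<bullet> z = a" by (simp add: a_def power2_norm_eq_inner)
  have "stereo x \<bullet> stereo x = (2 / (1 + a))\<^sup>2 * a + ((a - 1) / (a + 1))\<^sup>2"
    by (simp add: Fin zz flip: a_def) (simp add: power2_eq_square)
  also have "\<dots> = (4 * a + (a - 1)\<^sup>2) / (a + 1)\<^sup>2"
    by (simp add: power_divide add.commute add_divide_distrib)
  also have "4 * a + (a - 1)\<^sup>2 = (a + 1)\<^sup>2"
    by (simp add: power2_eq_square algebra_simps)
  finally show ?thesis using a by simp
qed simp

lemma norm_stereo [simp]: "norm (stereo x) = 1"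
  by (simp add: norm_eq_sqrt_inner inner_stereo_self)

lemma inj_stereo: "inj stereo"
proof (rule injI)
  have nle: "((cmod z)\<^sup>2 - 1) / ((cmod z)\<^sup>2 + 1) \<noteq> 1" for z
  proof -
    have "(cmod z)\<^sup>2 + 1 > 0" by (simp add: add_nonneg_pos)
    then show ?thesis by (simp add: divide_eq_eq)
  qed
  fix x y assume eq: "stereo x = stereo y"
  show "x = y"
  proof (cases x)
    case [simp]: (Fin z)
    show ?thesis
    proof (cases y)
      case [simp]: (Fin w)
      define a where "a = (cmod z)\<^sup>2"
      define b where "b = (cmod w)\<^sup>2"
      have ab: "a \<ge> 0" "b \<ge> 0" by (simp_all add: a_def b_def)
      have "(a - 1) / (a + 1) = (b - 1) / (b + 1)"
        using eq by (simp add: a_def b_def)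
      then have "a = b" using ab by (simp add: field_simps)
      moreover have "(2 / (1 + a)) *\<^sub>R z = (2 / (1 + b)) *\<^sub>R w"
        using eq by (simp add: a_def b_def)
      ultimately show ?thesis using ab by simp
    next
      case Infty
      then show ?thesis using eq nle[of z] by simp
    qed
  next
    case [simp]: Infty
    show ?thesis using eq nle by (cases y) (auto dest: sym)
  qed
qed

lemma abs_inner_stereo_le: "\<bar>stereo x \<bullet> stereo y\<bar> \<le> 1"
  using Cauchy_Schwarz_ineq2[of "stereo x" "stereo y"] by simp

lemma arccos_inner_triangle:
  fixes u v w :: "'a::real_inner"
  assumes "norm u = 1" "norm v = 1" "norm w = 1"
  shows "arccos (u \<bullet> w) \<le> arccos (u \<bullet> v) + arccos (v \<bullet> w)"
proof -
  have b: "\<bar>u \<bullet> v\<bar> \<le> 1" "\<bar>v \<bullet> w\<bar> \<le> 1" "\<bar>u \<bullet> w\<bar> \<le> 1"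
    using Cauchy_Schwarz_ineq2[of u v] Cauchy_Schwarz_ineq2[of v w]
      Cauchy_Schwarz_ineq2[of u w] assms by simp_all
  define p q where "p = u \<bullet> v" and "q = v \<bullet> w"
  have s: "u \<bullet> u = 1" "v \<bullet> v = 1" "w \<bullet> w = 1"
    using assms by (simp_all add: dot_square_norm)
  let ?f = "u - p *\<^sub>R v" and ?g = "w - q *\<^sub>R v"
  have nf: "norm ?f = sqrt (1 - p\<^sup>2)" and ng: "norm ?g = sqrt (1 - q\<^sup>2)"
    by (simp_all add: norm_eq_sqrt_inner inner_diff_left inner_diff_right s p_def q_def
        inner_commute power2_eq_square algebra_simps)
  have fg: "?f \<bullet> ?g = u \<bullet> w - p * q"
    by (simp add: inner_diff_left inner_diff_right s p_def q_def inner_commute algebra_simps)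
  have "\<bar>?f \<bullet> ?g\<bar> \<le> sqrt (1 - p\<^sup>2) * sqrt (1 - q\<^sup>2)"
    using Cauchy_Schwarz_ineq2[of ?f ?g] unfolding nf ng .
  then have *: "p * q - sqrt (1 - p\<^sup>2) * sqrt (1 - q\<^sup>2) \<le> u \<bullet> w"
    unfolding fg by linarith
  have pq: "\<bar>p\<bar> \<le> 1" "\<bar>q\<bar> \<le> 1" using b by (simp_all add: p_def q_def)
  have c: "cos (arccos p + arccos q) \<le> u \<bullet> w"
    using * pq by (simp add: cos_add sin_arccos_abs cos_arccos_abs)
  have nn: "0 \<le> arccos p" "0 \<le> arccos q"
    using pq by (auto intro!: arccos_lbound)
  have up: "arccos (u \<bullet> w) \<le> pi" using b(3) by (auto intro!: arccos_ubound)
  show ?thesis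
  proof (cases "arccos p + arccos q \<le> pi")
    case True
    have "arccos (u \<bullet> w) \<le> arccos (cos (arccos p + arccos q))"
      using c b(3) by (intro arccos_le_arccos) auto
    also have "\<dots> = arccos p + arccos q"
      using True nn by (intro arccos_cos) auto
    finally show ?thesis by (simp add: p_def q_def)
  next
    case False
    then show ?thesis using up by (simp add: p_def q_def)
  qed
qed

text \<open>The spherical distance is the length of a shortest great-circle arc between the
  stereographic projections. All topological and metric notions on
  \<open>ext_complex\<close> (open sets, closures, boundaries, diameters, circles) refer
  to this metric.\<close>

instantiation ext_complex :: metric_space
begin

definition dist_ext_complex :: "ext_complex \<Rightarrow> ext_complex \<Rightarrow> real" where
  "dist_ext_complex x y = arccos (stereo x \<bullet> stereo y)"

definition uniformity_ext_complex :: "(ext_complex \<times> ext_complex) filter" where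
  "uniformity_ext_complex = (INF e\<in>{0 <..}. principal {(x, y). dist x y < e})"

definition open_ext_complex :: "ext_complex set \<Rightarrow> bool" where
  "open_ext_complex U \<longleftrightarrow>
     (\<forall>x\<in>U. eventually (\<lambda>(x', y). x' = x \<longrightarrow> y \<in> U) uniformity)"

instance
proof
  fix x y z :: ext_complex
  show "(dist x y = 0) = (x = y)"
  proof
    assume "dist x y = 0"
    then have "cos (arccos (stereo x \<bullet> stereo y)) = 1"
      by (simp add: dist_ext_complex_def)
    then have "stereo x \<bullet> stereo y = 1"
      using abs_inner_stereo_le[of x y] by (simp add: cos_arccos_abs)
    then have "(stereo x - stereo y) \<bullet> (stereo x - stereo y) = 0"
      by (simp add: inner_diff_left inner_diff_right inner_stereo_self inner_commute)
    then show "x = y" using inj_stereo by (simp add: inj_eq)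
  qed (simp add: dist_ext_complex_def inner_stereo_self)
  show "dist x y \<le> dist x z + dist y z"
    unfolding dist_ext_complex_def
    using arccos_inner_triangle[of "stereo x" "stereo z" "stereo y"]
    by (simp add: inner_commute)
qed (simp_all add: uniformity_ext_complex_def open_ext_complex_def)

end

section \<open>Domains, Peano compacta, oscillations\<close>

definition is_domain :: "ext_complex set \<Rightarrow> bool" where
  "is_domain U \<longleftrightarrow> open U \<and> connected U"

definition Jordan_curve :: "'a::topological_space set \<Rightarrow> bool" where
  "Jordan_curve J \<longleftrightarrow>
     (\<exists>g. simple_path g \<and> pathfinish g = pathstart g \<and> path_image g = J)"

definition null_family :: "'a::metric_space set set \<Rightarrow> bool" where
  "null_family \<J> \<longleftrightarrow> finite \<J> \<or>
     (\<exists>J. bij_betw J (UNIV :: nat set) \<J> \<and> (\<lambda>n. diameter (J n)) \<longlonglongrightarrow> 0)"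

definition generalized_Jordan_domain :: "ext_complex set \<Rightarrow> bool" where
  "generalized_Jordan_domain U \<longleftrightarrow>
     is_domain U \<and>
     (\<forall>K \<in> components (frontier U). (\<exists>p. K = {p}) \<or> Jordan_curve K) \<and>
     countable {K \<in> components (frontier U). Jordan_curve K} \<and>
     null_family {K \<in> components (frontier U). Jordan_curve K}"

definition Peano_continuum :: "'a::topological_space set \<Rightarrow> bool" where
  "Peano_continuum K \<longleftrightarrow> (\<exists>g. path g \<and> path_image g = K)"

definition Peano_compactum :: "'a::metric_space set \<Rightarrow> bool" where
  "Peano_compactum X \<longleftrightarrow>
     compact X \<and>
     (\<forall>K \<in> components X. Peano_continuum K) \<and>
     (\<forall>C>0. finite {K \<in> components X. diameter K > C})"

text \<open>The circle with centre \<open>z\<^sub>0\<close> and radius \<open>r\<close> is taken with respect to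
  the spherical metric, so that \<open>z\<^sub>0 = Infty\<close> needs no separate convention. The library's
  \<open>diameter\<close> of the image is the supremum of the spherical distances between
  \<open>\<phi> x\<close> and \<open>\<phi> y\<close>, and is \<open>0\<close> if the circle misses \<open>U\<close>.\<close>

definition oscillation ::
    "(ext_complex \<Rightarrow> ext_complex) \<Rightarrow> ext_complex set \<Rightarrow> ext_complex \<Rightarrow> real \<Rightarrow> real" where
  "oscillation \<phi> U z\<^sub>0 r = diameter (\<phi> ` (sphere z\<^sub>0 r \<inter> U))"

definition continuous_extension ::
    "ext_complex set \<Rightarrow> ext_complex set \<Rightarrow> (ext_complex \<Rightarrow> ext_complex) \<Rightarrow>
     (ext_complex \<Rightarrow> ext_complex) \<Rightarrow> bool" where
  "continuous_extension U \<Omega> \<phi> \<Phi> \<longleftrightarrow>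
     continuous_on (closure U) \<Phi> \<and>
     \<Phi> ` closure U \<subseteq> closure \<Omega> \<and>
     (\<forall>z\<in>U. \<Phi> z = \<phi> z)"

end

theory Submission
  imports Defs
begin

text \<open>
  The one tool from plane topology is Janiszewski's theorem: if neither of two closed sets separates
  two points and their intersection is connected, then the union does not separate the points
  either. It is used together with the fact that two points separated by a closed set are separated
  by one of its components. Both are moved from the plane to the sphere by puncturing the sphere.

  For a domain \<open>\<Omega>\<close> and a closed set \<open>E\<close>, consider two points of \<open>\<Omega>\<close> that \<open>E\<close> separates in \<open>\<Omega>\<close>.
  A component of \<open>E \<union> frontier \<Omega>\<close> separates them, and it cannot lie in \<open>frontier \<Omega>\<close>, so it
  meets \<open>E\<close>. Hence only \<open>E\<close> and the boundary components that meet \<open>E\<close> are responsible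
  (\<open>connected_component_avoiding\<close>). A long boundary component \<open>X\<^sub>0\<close> among them can be removed
  by Janiszewski's theorem, because \<open>X\<^sub>0\<close> alone separates nothing in \<open>\<Omega>\<close>; what must be
  arranged is that the rest meets \<open>X\<^sub>0\<close> in a connected set
  (\<open>connected_component_across_component\<close>). These two lemmas carry the arguments below.

  Suppose the extension \<open>\<Phi>\<close> exists. All points of \<open>\<Omega>\<close> close to a boundary component \<open>Q\<close> can be
  joined inside \<open>\<Omega>\<close> near \<open>Q\<close>; pulling such connections back shows that the preimage of \<open>Q\<close> is
  connected (\<open>connected_fibre\<close>). So \<open>\<Phi>\<close> induces a bijection between the boundary components,
  the components of \<open>frontier \<Omega>\<close> are images of points and Jordan curves, and uniform continuity
  transfers the finiteness condition. The oscillations tend to zero for the same reason.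

  Conversely, let \<open>frontier \<Omega>\<close> be a Peano compactum and take a circle about a boundary point of
  \<open>U\<close> whose image has a tiny closure \<open>E\<close> near some \<open>w \<in> frontier \<Omega>\<close>. The component \<open>X\<^sub>0\<close> of \<open>w\<close>
  has a small connected neighbourhood \<open>C\<close> of \<open>w\<close>, and the other boundary components that meet
  \<open>E\<close> are small; so \<open>E\<close> cannot separate two points of \<open>\<Omega>\<close> that are away from \<open>w\<close>. As the circle
  separates its interior from a fixed point of \<open>U\<close>, the whole image of the interior is close to
  \<open>w\<close> (\<open>limit_at_boundary_point\<close>).

  If \<open>\<Omega>\<close> is a generalized Jordan domain, then the part of \<open>X\<^sub>0\<close> outside a small neighbourhood of
  \<open>y \<in> X\<^sub>0\<close> lies in a connected subset of \<open>X\<^sub>0\<close> that misses \<open>y\<close>, an arc of the curve. With this set as \<open>C\<close>, points of \<open>\<Omega>\<close> near \<open>y\<close> can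
  be joined in \<open>\<Omega>\<close> near \<open>y\<close>, and again by pulling back the fibre over \<open>y\<close> is connected. In the
  other direction, a monotone map sends a Jordan curve to a point or to a Jordan curve
  (\<open>monotone_image_Jordan_curve\<close>). Finally, a connected fibre with two points lies on
  a Jordan curve and therefore contains an arc, so without collapsed arcs \<open>\<Phi>\<close> is injective.
\<close>

section \<open>The sphere as a topological space\<close>

text \<open>The chord is at most as long as the great-circle arc: with \<open>d = dist x y\<close> its length is
  \<open>2 \<bar>sin (d / 2)\<bar>\<close>.\<close>

lemma norm_stereo_diff: "norm (stereo x - stereo y) \<le> dist x y"
proof -
  define d where "d = dist x y"
  have c: "stereo x \<bullet> stereo y = cos d"
    using abs_inner_stereo_le[of x y] by (simp add: d_def dist_ext_complex_def cos_arccos_abs)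
  have "(norm (stereo x - stereo y))\<^sup>2 = 2 - 2 * cos d"
    by (simp add: power2_norm_eq_inner inner_diff_left inner_diff_right inner_stereo_self
        inner_commute c[symmetric])
  also have "\<dots> = 4 * (sin (d / 2))\<^sup>2"
    using cos_double_sin[of "d/2"] by simp
  also have "\<dots> = (2 * \<bar>sin (d / 2)\<bar>)\<^sup>2"
    by (simp add: power2_eq_square)
  also have "\<dots> \<le> d\<^sup>2"
    using abs_sin_x_le_abs_x[of "d/2"] zero_le_dist[of x y] unfolding d_def by (intro power_mono) auto
  finally show ?thesis
    using zero_le_dist[of x y] unfolding d_def by (rule power2_le_imp_le)
qed

lemma stereo_image: "range stereo = sphere 0 1"
proof
  show "sphere 0 1 \<subseteq> range stereo"
  proof
    fix v :: "complex \<times> real" assume "v \<in> sphere 0 1"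
    then obtain z t where v: "v = (z, t)" and n: "(cmod z)\<^sup>2 + t\<^sup>2 = 1"
      by (cases v) (auto simp: norm_Pair)
    show "v \<in> range stereo"
    proof (cases "t = 1")
      case True
      then have "v = stereo Infty" using v n by simp
      then show ?thesis by blast
    next
      case False
      then have t: "1 - t \<noteq> 0" by simp
      \<comment> \<open>The inverse of stereographic projection sends \<open>(z, t)\<close> to \<open>z / (1 - t)\<close>.\<close>
      define a where "a = (cmod (z /\<^sub>R (1 - t)))\<^sup>2"
      have "a = (1 - t\<^sup>2) / (1 - t)\<^sup>2"
        using n by (simp add: a_def power_mult_distrib power_inverse divide_inverse)
      also have "1 - t\<^sup>2 = (1 + t) * (1 - t)" by (simp add: power2_eq_square algebra_simps)
      finally have a: "a * (1 - t) = 1 + t"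
        using t by (simp add: power2_eq_square)
      then have a1: "(1 + a) * (1 - t) = 2" by (simp add: algebra_simps)
      then have nz: "1 + a \<noteq> 0" by auto
      have e1: "2 / (1 + a) = 1 - t" using a1 nz by (simp add: field_simps)
      have "a - 1 = t * (a + 1)" using a by (simp add: algebra_simps)
      then have e2: "(a - 1) / (a + 1) = t" using nz by (simp add: field_simps)
      have "stereo (Fin (z /\<^sub>R (1 - t))) = ((2 / (1 + a)) *\<^sub>R (z /\<^sub>R (1 - t)), (a - 1) / (a + 1))"
        by (simp add: a_def)
      also have "\<dots> = v" unfolding e1 e2 using t v by simp
      finally show ?thesis by (metis rangeI)
    qed
  qed
qed auto

lemma homeomorphism_stereo: "homeomorphism UNIV (sphere 0 1) stereo (inv stereo)"
proof (rule homeomorphismI)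
  show "continuous_on UNIV stereo"
  proof (rule continuous_onI)
    fix x :: ext_complex and e :: real assume "e > 0"
    moreover have "dist (stereo x') (stereo x) \<le> e" if "dist x' x < e" for x'
      using norm_stereo_diff[of x' x] that by (simp add: dist_norm)
    ultimately show "\<exists>d>0. \<forall>x'\<in>UNIV. dist x' x < d \<longrightarrow> dist (stereo x') (stereo x) \<le> e"
      by blast
  qed
  have d: "dist (inv stereo u) (inv stereo v) = arccos (u \<bullet> v)" if "norm u = 1" "norm v = 1" for u v
    using that stereo_image by (simp add: dist_ext_complex_def f_inv_into_f)
  show "continuous_on (sphere 0 1) (inv stereo)"
    unfolding continuous_on_def
  proof (intro ballI)
    fix u :: "complex \<times> real" assume u: "u \<in> sphere 0 1"
    have "\<bar>v \<bullet> u\<bar> \<le> 1" if "v \<in> sphere 0 1" for v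
      using u that Cauchy_Schwarz_ineq2[of v u] by simp
    then have "\<forall>v \<in> sphere 0 1. - 1 \<le> v \<bullet> u \<and> v \<bullet> u \<le> 1"
      unfolding abs_le_iff by fastforce
    then have "continuous_on (sphere 0 1) (\<lambda>v. arccos (v \<bullet> u))"
      by (intro continuous_on_arccos continuous_intros)
    then have "((\<lambda>v. arccos (v \<bullet> u)) \<longlongrightarrow> arccos (u \<bullet> u)) (at u within sphere 0 1)"
      using u by (auto simp: continuous_on_def)
    then have "((\<lambda>v. arccos (v \<bullet> u)) \<longlongrightarrow> 0) (at u within sphere 0 1)"
      using u by (simp add: dot_square_norm)
    then show "(inv stereo \<longlongrightarrow> inv stereo u) (at u within sphere 0 1)"
      unfolding tendsto_dist_iff[of "inv stereo"]
      using u by (auto elim!: Lim_transform_eventually simp: d eventually_at_filter)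
  qed
  show "inv stereo (stereo x) = x" for x by (simp add: inj_stereo)
  show "stereo (inv stereo v) = v" if "v \<in> sphere 0 1" for v
    using that stereo_image by (simp add: f_inv_into_f)
qed (use stereo_image in auto)

lemma ext_complex_homeomorphic_sphere:
  "(UNIV :: ext_complex set) homeomorphic sphere (0 :: complex \<times> real) 1"
  using homeomorphism_stereo unfolding homeomorphic_def by blast

lemma compact_UNIV_ext: "compact (UNIV :: ext_complex set)"
  using homeomorphic_compactness[OF ext_complex_homeomorphic_sphere] by (simp only: compact_sphere)

lemma compact_iff_closed_ext: "compact (S :: ext_complex set) \<longleftrightarrow> closed S"
  using compact_Int_closed[OF compact_UNIV_ext, of S] compact_imp_closed by auto

lemma bounded_ext: "bounded (S :: ext_complex set)"
  using bounded_subset compact_imp_bounded compact_UNIV_ext by blast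

lemma connected_UNIV_ext: "connected (UNIV :: ext_complex set)"
  using homeomorphic_connectedness[OF ext_complex_homeomorphic_sphere]
  by (simp add: connected_sphere_eq)

text \<open>A chart around every point except an arbitrarily chosen one; letting \<open>q\<close> vary avoids explicit
  Moebius transformations.\<close>

lemma punctured_ext_homeomorphic_complex:
  obtains h k where "homeomorphism (- {q :: ext_complex}) (UNIV :: complex set) h k"
proof -
  have *: "homeomorphism (- {q}) (sphere 0 1 - {stereo q}) stereo (inv stereo)"
  proof (rule homeomorphism_of_subsets[OF homeomorphism_stereo])
    show "stereo ` (- {q}) = sphere 0 1 - {stereo q}"
      using stereo_image inj_stereo by (auto simp: inj_def)
  qed auto
  have "(sphere (0 :: complex \<times> real) 1 - {stereo q}) homeomorphic (UNIV :: complex set)"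
    by (rule homeomorphic_punctured_sphere_affine) auto
  then obtain f g where "homeomorphism (sphere 0 1 - {stereo q}) (UNIV :: complex set) f g"
    unfolding homeomorphic_def by blast
  with * show ?thesis using that homeomorphism_compose by blast
qed

lemma open_component_ext:
  assumes "open (V :: ext_complex set)" shows "open (connected_component_set V x)"
proof -
  have "locally connected (UNIV :: ext_complex set) \<longleftrightarrow> locally connected (sphere (0::complex \<times> real) 1)"
    by (rule homeomorphic_locally[OF ext_complex_homeomorphic_sphere]) (rule homeomorphic_connectedness)
  then have "locally connected (UNIV :: ext_complex set)" by (simp only: locally_connected_sphere)
  then have *: "openin (top_of_set UNIV) (connected_component_set V x)" if "x \<in> V"
    using assms that by (intro locally_connected_2[of UNIV V]) simp_all
  show ?thesis
  proof (cases "x \<in> V")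
    case True
    then show ?thesis using * by simp
  next
    case False
    then have "connected_component_set V x = {}" by (subst connected_component_eq_empty)
    then show ?thesis by (simp only: open_empty)
  qed
qed

lemma islimpt_UNIV_ext: "(q :: ext_complex) islimpt UNIV"
proof (rule connected_imp_perfect[OF connected_UNIV_ext])
  show "UNIV \<noteq> {x}" for x :: ext_complex by (metis UNIV_I ext_complex.distinct(1) singletonD)
qed simp

section \<open>Separation of the sphere\<close>

text \<open>Deleting a point from a planar domain keeps it connected; on the sphere, a point outside \<open>V\<close> is
  used to flatten \<open>V\<close>, and the whole sphere minus a point is itself a plane.\<close>

lemma connected_open_delete_ext:
  assumes V: "open V" "connected V"
  shows "connected (V - {q :: ext_complex})"
proof (cases "V = UNIV")
  case True
  obtain h k where "homeomorphism (- {q}) (UNIV :: complex set) h k"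
    by (rule punctured_ext_homeomorphic_complex)
  then have "- {q} = k ` UNIV" "continuous_on UNIV k"
    by (auto simp: homeomorphism_def)
  then have "connected (- {q})" using connected_continuous_image connected_UNIV by metis
  then show ?thesis using True by (simp add: Compl_eq_Diff_UNIV)
next
  case False
  then obtain s where s: "s \<notin> V" by auto
  obtain h k where hk: "homeomorphism (- {s}) (UNIV :: complex set) h k"
    by (rule punctured_ext_homeomorphic_complex)
  have V': "V \<subseteq> - {s}" using s by auto
  show ?thesis
  proof (cases "q \<in> V")
    case True
    have "openin (top_of_set (UNIV :: complex set)) (h ` V)"
      by (rule homeomorphism_imp_open_map[OF hk]) (rule open_subset[OF V' V(1)])
    then have "open (h ` V)" by simp
    moreover have "connected (h ` V)"
      using hk V V' by (meson connected_continuous_image continuous_on_subset homeomorphism_cont1)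
    ultimately have "connected (h ` V - {h q})"
      by (intro connected_open_delete) auto
    then have "connected (k ` (h ` V - {h q}))"
      using hk by (meson connected_continuous_image continuous_on_subset homeomorphism_cont2 subset_UNIV)
    moreover have "k ` (h ` V - {h q}) = V - {q}"
    proof -
      have kh: "k (h v) = v" if "v \<in> V" for v
        using hk V' that by (auto simp: homeomorphism_def)
      have "h ` V - {h q} = h ` (V - {q})"
        using kh True by (auto simp: image_iff) metis
      then show ?thesis using kh by (force simp: image_image)
    qed
    ultimately show ?thesis by simp
  qed (use V in simp)
qed

lemma connected_component_delete_ext:
  assumes V: "open V" and ab: "connected_component V a b" and "a \<noteq> q" "b \<noteq> (q :: ext_complex)"
  shows "connected_component (V - {q}) a b"
proof (rule connected_componentI)
  show "connected (connected_component_set V a - {q})"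
    by (intro connected_open_delete_ext open_component_ext V) simp
  show "connected_component_set V a - {q} \<subseteq> V - {q}"
    using connected_component_subset by blast
  show "a \<in> connected_component_set V a - {q}" "b \<in> connected_component_set V a - {q}"
    using assms connected_component_in[OF ab] by (auto simp: connected_component_refl)
qed

lemma connected_component_chart:
  assumes hk: "homeomorphism (- {q :: ext_complex}) (UNIV :: complex set) h k"
    and A: "A \<subseteq> - {q}" and a: "a \<noteq> q" and b: "b \<noteq> q"
  shows "connected_component (h ` A) (h a) (h b) \<longleftrightarrow> connected_component A a b"
proof
  have "homeomorphism A (h ` A) h k"
    by (rule homeomorphism_of_subsets[OF hk A subset_UNIV refl])
  note * = connected_component_homeomorphismI[OF this]
    connected_component_homeomorphismI[OF homeomorphism_symD[OF this]]
  show "connected_component A a b \<Longrightarrow> connected_component (h ` A) (h a) (h b)"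
    by (rule *)
  have "k (h a) = a" "k (h b) = b" using hk a b by (auto simp: homeomorphism_def)
  then show "connected_component (h ` A) (h a) (h b) \<Longrightarrow> connected_component A a b"
    using *(2)[of "h a" "h b"] by simp
qed

lemma chart_image_Compl:
  assumes hk: "homeomorphism (- {q :: ext_complex}) (UNIV :: complex set) h k"
  shows "h ` (- A - {q}) = - h ` (A - {q})"
proof -
  have 1: "k (h x) = x" if "x \<noteq> q" for x using hk that by (auto simp: homeomorphism_def)
  have 2: "h (k z) = z" "k z \<noteq> q" for z using hk by (auto simp: homeomorphism_def)
  show ?thesis
  proof
    show "h ` (- A - {q}) \<subseteq> - h ` (A - {q})" using 1 by (auto simp: image_iff) metis
    show "- h ` (A - {q}) \<subseteq> h ` (- A - {q})"
    proof
      fix z assume "z \<in> - h ` (A - {q})"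
      then have "k z \<notin> A" using 2[of z] by (metis ComplD DiffI image_eqI singletonD)
      then have "k z \<in> - A - {q}" using 2(2) by simp
      then show "z \<in> h ` (- A - {q})" using 2(1)[of z] by (metis imageI)
    qed
  qed
qed

text \<open>The puncture is placed in \<open>T\<close> but outside \<open>S\<close>. Then \<open>S\<close> becomes compact, \<open>T\<close> becomes closed, and their
  intersection does not lose a point, so that it remains connected.\<close>

theorem Janiszewski_ext:
  fixes a b :: ext_complex
  assumes S: "closed S" and T: "closed T" and ST: "connected (S \<inter> T)"
    and a: "connected_component (- S) a b" and b: "connected_component (- T) a b"
  shows "connected_component (- (S \<union> T)) a b"
proof (cases "T \<subseteq> S")
  case True
  then show ?thesis using a by (simp add: Un_absorb2)
next
  case False
  then obtain q where q: "q \<in> T" "q \<notin> S" by auto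
  have abq: "a \<noteq> q" "b \<noteq> q" using connected_component_in[OF b] q by auto
  obtain h k where hk: "homeomorphism (- {q}) (UNIV :: complex set) h k"
    by (rule punctured_ext_homeomorphic_complex)
  have inj: "inj_on h (- {q})"
    using hk by (metis homeomorphism_def inj_on_inverseI)
  have cont: "continuous_on (- {q}) h" using hk by (simp add: homeomorphism_def)
  have S': "S - {q} = S" "S \<subseteq> - {q}" using q by auto
  have "connected_component (- (h ` S \<union> h ` (T - {q}))) (h a) (h b)"
  proof (rule Janiszewski)
    show "compact (h ` S)"
      using S S' cont compact_continuous_image continuous_on_subset compact_iff_closed_ext by metis
    have "closedin (top_of_set (UNIV :: complex set)) (h ` (T - {q}))"
      by (rule homeomorphism_imp_closed_map[OF hk]) (use closedin_closed_Int[OF T, of "- {q}"] in \<open>simp add: Diff_eq Int_commute\<close>)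
    then show "closed (h ` (T - {q}))" by simp
    have "h ` S \<inter> h ` (T - {q}) = h ` (S \<inter> T)"
      using inj S' by (subst inj_on_image_Int[OF inj, symmetric]) (auto intro: arg_cong[of _ _ "(`) h"])
    moreover have "connected (h ` (S \<inter> T))"
      using ST S' cont by (meson connected_continuous_image continuous_on_subset inf.coboundedI1)
    ultimately show "connected (h ` S \<inter> h ` (T - {q}))" by simp
    have "connected_component (- S - {q}) a b"
      by (rule connected_component_delete_ext) (use S a abq in auto)
    then show "connected_component (- h ` S) (h a) (h b)"
      using connected_component_chart[OF hk _ abq, of "- S - {q}"] chart_image_Compl[OF hk, of S] S'
      by auto
    have "- T - {q} = - T" using q by auto
    then show "connected_component (- h ` (T - {q})) (h a) (h b)"
      using connected_component_chart[OF hk _ abq, of "- T - {q}"] chart_image_Compl[OF hk, of T] b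
      by auto
  qed
  moreover have "- (S \<union> T) - {q} = - (S \<union> T)" using q by auto
  moreover have "h ` S \<union> h ` (T - {q}) = h ` (S \<union> T - {q})" using q by (auto simp: image_iff)
  ultimately show ?thesis
    using connected_component_chart[OF hk _ abq, of "- (S \<union> T) - {q}"] chart_image_Compl[OF hk, of "S \<union> T"]
    by auto
qed

text \<open>Here the puncture lies outside \<open>G\<close> so that the components of \<open>G\<close> do not change. Since the
  complement of \<open>G\<close> is open and nonempty, it contains a point other than \<open>a\<close> and \<open>b\<close>.\<close>

theorem separation_by_component_ext:
  fixes a b :: ext_complex
  assumes G: "closed G" and ab: "a \<notin> G" "b \<notin> G" and sep: "\<not> connected_component (- G) a b"
  obtains Z where "Z \<in> components G" "\<not> connected_component (- Z) a b"
proof -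
  have "infinite (- G)"
    using islimpt_UNIV_ext[of a] G ab unfolding islimpt_eq_acc_point by (metis ComplI inf_top_right open_Compl)
  then have "infinite (- G - {a, b})" by simp
  then obtain q where q: "q \<notin> G" "q \<noteq> a" "q \<noteq> b"
    using infinite_imp_nonempty by blast
  obtain h k where hk: "homeomorphism (- {q}) (UNIV :: complex set) h k"
    by (rule punctured_ext_homeomorphic_complex)
  have kh: "k (h x) = x" if "x \<noteq> q" for x using hk that by (auto simp: homeomorphism_def)
  have cont: "continuous_on (- {q}) h" "continuous_on UNIV k" using hk by (auto simp: homeomorphism_def)
  have Gq: "G \<subseteq> - {q}" "G - {q} = G" using q by auto
  have "compact (h ` G)"
    using G Gq cont compact_continuous_image continuous_on_subset compact_iff_closed_ext by metis
  then have "closed (h ` G)" by (rule compact_imp_closed)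
  moreover have "\<not> connected_component (- G - {q}) a b"
    using sep connected_component_of_subset by blast
  then have "\<not> connected_component (- h ` G) (h a) (h b)"
    using connected_component_chart[OF hk _ , of "- G - {q}" a b] chart_image_Compl[OF hk, of G] q Gq by auto
  ultimately obtain C where C: "C \<in> components (h ` G)" "\<not> connected_component (- C) (h a) (h b)"
    by (rule separation_by_component_closed_pointwise)
  define Z where "Z = k ` C"
  have CG: "C \<subseteq> h ` G" using C(1) by (rule in_components_subset)
  have hZ: "h ` Z = C" using hk by (auto simp: Z_def homeomorphism_def image_iff)
  have ZG: "Z \<subseteq> G"
    using CG kh Gq by (force simp: Z_def)
  have "Z \<in> components G"
    unfolding in_components_maximal
  proof (intro conjI allI impI)
    show "Z \<noteq> {}" using C(1) by (auto simp: Z_def in_components_nonempty)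
    show "Z \<subseteq> G" by (rule ZG)
    show "connected Z"
      unfolding Z_def using in_components_connected[OF C(1)] cont
      by (meson connected_continuous_image continuous_on_subset subset_UNIV)
    fix D assume D: "D \<noteq> {} \<and> Z \<subseteq> D \<and> D \<subseteq> G \<and> connected D"
    have "connected (h ` D)"
      using D Gq cont by (meson connected_continuous_image continuous_on_subset order_trans)
    then have "h ` D = C"
      using C(1) D hZ unfolding in_components_maximal by (metis image_is_empty image_mono)
    moreover have "k ` h ` D = D" using kh D Gq by (force simp: image_image)
    ultimately show "D = Z" by (simp add: Z_def)
  qed
  moreover have "\<not> connected_component (- Z) a b"
  proof
    assume "connected_component (- Z) a b"
    then have "connected_component (- Z - {q}) a b"
      using closed_components[OF G \<open>Z \<in> components G\<close>] q by (intro connected_component_delete_ext) auto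
    then have "connected_component (- h ` (Z - {q})) (h a) (h b)"
      using connected_component_chart[OF hk _ , of "- Z - {q}" a b] chart_image_Compl[OF hk, of Z] q by auto
    then show False using C hZ ZG Gq by (metis Diff_empty Diff_insert0 q(1) subsetD)
  qed
  ultimately show ?thesis using that by blast
qed

text \<open>Images of Euclidean discs under a chart. Their complement is the image of the connected exterior
  of the disc together with the omitted point \<open>q\<close>, which is a limit of that exterior.\<close>

lemma small_nbhd_connected_complement:
  assumes "0 < e"
  obtains O' where "open O'" "(w :: ext_complex) \<in> O'" "O' \<subseteq> ball w e" "connected (- O')"
proof -
  obtain q :: ext_complex where q: "q \<noteq> w" by (metis ext_complex.distinct(1))
  obtain h k where hk: "homeomorphism (- {q}) (UNIV :: complex set) h k"
    by (rule punctured_ext_homeomorphic_complex)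
  have kh: "k (h x) = x" if "x \<noteq> q" for x using hk that by (auto simp: homeomorphism_def)
  have hk': "h (k z) = z" "k z \<noteq> q" for z using hk by (auto simp: homeomorphism_def)
  have cont: "continuous_on UNIV k" using hk by (auto simp: homeomorphism_def)
  have "open (k -` ball w e)"
    using cont open_ball continuous_on_open_vimage[of UNIV k] by auto
  moreover have "h w \<in> k -` ball w e" using kh q assms by auto
  ultimately obtain r where r: "r > 0" "ball (h w) r \<subseteq> k -` ball w e"
    using openE by metis
  define O' where "O' = k ` ball (h w) r"
  have opn: "open (k ` W)" if "open W" for W
  proof -
    have "openin (top_of_set (- {q})) (k ` W)"
      by (rule homeomorphism_imp_open_map[OF homeomorphism_symD[OF hk]]) (simp add: that)
    then show ?thesis by (metis open_Compl closed_singleton openin_open_eq)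
  qed
  have "open O'" unfolding O'_def by (rule opn) simp
  moreover have "w \<in> O'" unfolding O'_def using kh[of w] q r by (metis centre_in_ball image_eqI)
  moreover have "O' \<subseteq> ball w e" using r by (auto simp: O'_def)
  moreover have "connected (- O')"
  proof (rule connected_intermediate_closure)
    have "connected (- ball (h w) r)"
      by (intro connected_complement_bounded_convex) auto
    then show "connected (k ` (- ball (h w) r))"
      using cont by (meson connected_continuous_image continuous_on_subset subset_UNIV)
    show "k ` (- ball (h w) r) \<subseteq> - O'"
      using hk' by (auto simp: O'_def) metis
    show "- O' \<subseteq> closure (k ` (- ball (h w) r))"
    proof
      fix x assume x: "x \<in> - O'"
      show "x \<in> closure (k ` (- ball (h w) r))"
      proof (cases "x = q")
        case False
        then have "k (h x) = x" using kh by simp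
        with x have "x \<in> k ` (- ball (h w) r)" by (metis ComplD ComplI O'_def image_eqI)
        then show ?thesis by (rule subsetD[OF closure_subset])
      next
        case True
        have "compact (k ` cball (h w) r)"
          using cont by (meson compact_cball compact_continuous_image continuous_on_subset subset_UNIV)
        then have cl: "closed (k ` cball (h w) r)" by (rule compact_imp_closed)
        show ?thesis
          unfolding True closure_iff_nhds_not_empty
        proof (intro allI impI)
          fix A V assume V: "V \<subseteq> A" "open V" "q \<in> V"
          then have "open (V - k ` cball (h w) r)" "q \<in> V - k ` cball (h w) r"
            using cl hk' by auto
          then obtain y where "y \<in> V - k ` cball (h w) r" "y \<noteq> q"
            using islimpt_UNIV_ext[of q] unfolding islimpt_def by blast
          moreover from this have y: "y = k (h y)" using kh by simp
          moreover have "h y \<in> - ball (h w) r"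
          proof
            assume "h y \<in> ball (h w) r"
            then have "y \<in> k ` cball (h w) r" using y ball_subset_cball by blast
            with \<open>y \<in> V - _\<close> show False by simp
          qed
          ultimately show "k ` (- ball (h w) r) \<inter> A \<noteq> {}"
            using V by (metis DiffD1 IntI empty_iff image_eqI subsetD)
        qed
      qed
    qed
  qed
  ultimately show ?thesis using that by blast
qed

section \<open>Connecting points of a domain past a closed set\<close>

definition components_meeting :: "'a::topological_space set \<Rightarrow> 'a set \<Rightarrow> 'a set" where
  "components_meeting X E = \<Union>{Y \<in> components X. Y \<inter> E \<noteq> {}}"

text \<open>In a compact space the components coincide with the quasicomponents; this is the form of that
  fact used below.\<close>

lemma clopen_avoiding:
  fixes X E :: "'a::metric_space set"
  assumes X: "compact X" and E: "closed E" and x: "x \<in> X"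
    and dis: "connected_component_set X x \<inter> E = {}"
  obtains Q where "openin (top_of_set X) Q" "closedin (top_of_set X) Q" "x \<in> Q" "Q \<inter> E = {}"
proof -
  have "separated_between (top_of_set X) {x} (X \<inter> E)"
  proof (rule cut_wire_fence_theorem)
    show "compact_space (top_of_set X)" using X by (simp add: compact_space_subtopology)
    show "Hausdorff_space (top_of_set X)" by (simp add: Hausdorff_space_subtopology[OF Hausdorff_space_euclidean])
    show "closedin (top_of_set X) {x}" using x by (simp add: closedin_closed) (metis Int_insert_right_if1 Int_empty_right closed_singleton)
    show "closedin (top_of_set X) (X \<inter> E)" using E by (rule closedin_closed_Int)
    fix C assume "connectedin (top_of_set X) C"
    then have C: "C \<subseteq> X" "connected C" by (auto simp: connectedin_subtopology)
    show "disjnt C {x} \<or> disjnt C (X \<inter> E)"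
    proof (cases "x \<in> C")
      case True
      then have "C \<subseteq> connected_component_set X x" using C by (simp add: connected_component_maximal)
      then show ?thesis using dis by (auto simp: disjnt_def)
    qed (simp add: disjnt_def)
  qed
  then obtain Q V where Q: "openin (top_of_set X) Q" "openin (top_of_set X) V" "Q \<union> V = X"
      "disjnt Q V" "x \<in> Q" "X \<inter> E \<subseteq> V"
    by (auto simp: separated_between_def)
  moreover have "Q = X - V" using Q by (auto simp: disjnt_def)
  then have "closedin (top_of_set X) Q" using Q(2) by (metis closedin_diff closedin_subtopology_refl closedin_topspace openin_closedin_eq topspace_euclidean_subtopology)
  moreover have "Q \<inter> E = {}" using Q by (auto simp: disjnt_def)
  ultimately show ?thesis using that by blast
qed

text \<open>A point whose component misses \<open>E\<close> has a clopen neighbourhood in \<open>X\<close> that misses \<open>E\<close>, and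
  no component of \<open>X\<close> can cross its border.\<close>

lemma closed_components_meeting:
  fixes X E :: "'a::metric_space set"
  assumes X: "compact X" and E: "closed E"
  shows "closed (components_meeting X E)"
  unfolding closed_def open_subopen[of "- _"]
proof
  fix x assume x: "x \<in> - components_meeting X E"
  show "\<exists>W. open W \<and> x \<in> W \<and> W \<subseteq> - components_meeting X E"
  proof (cases "x \<in> X")
    case False
    moreover have "components_meeting X E \<subseteq> X"
      by (auto simp: components_meeting_def dest: in_components_subset)
    ultimately show ?thesis using compact_imp_closed[OF X] by (intro exI[of _ "- X"]) auto
  next
    case True
    then have "connected_component_set X x \<inter> E = {}"
      using x componentsI[OF True] by (auto simp: components_meeting_def connected_component_refl)
    then obtain Q where Q: "openin (top_of_set X) Q" "closedin (top_of_set X) Q" "x \<in> Q" "Q \<inter> E = {}"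
      using clopen_avoiding[OF X E True] by blast
    then obtain W where W: "open W" "Q = X \<inter> W" by (auto simp: openin_open)
    have "W \<inter> Y = {}" if Y: "Y \<in> components X" "Y \<inter> E \<noteq> {}" for Y
    proof (rule ccontr)
      assume "W \<inter> Y \<noteq> {}"
      then have "Q \<inter> Y \<noteq> {}" using W in_components_subset[OF Y(1)] by auto
      moreover have "closed Q" using Q(2) compact_imp_closed[OF X] by (rule closedin_closed_trans)
      moreover have "closed (X - Q)"
        using closedin_closed_trans[OF closedin_diff[OF closedin_subtopology_refl[THEN iffD2] Q(1)] compact_imp_closed[OF X]]
        by simp
      ultimately have "Y \<inter> (X - Q) = {}"
        using in_components_connected[OF Y(1)] in_components_subset[OF Y(1)]
        unfolding connected_closed by blast
      then have "Y \<subseteq> Q" using in_components_subset[OF Y(1)] by auto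
      then show False using Q Y by auto
    qed
    then show ?thesis
      using W Q by (intro exI[of _ W]) (auto simp: components_meeting_def)
  qed
qed

text \<open>A component of \<open>X\<close> that misses \<open>E\<close> can be cut off from \<open>E \<union> X\<close> by a clopen set, so it is not
  attached to any component that meets \<open>E\<close>.\<close>

lemma component_Un_subset:
  fixes X E :: "'a::metric_space set"
  assumes X: "compact X" and E: "closed E" and Z: "Z \<in> components (E \<union> X)" "Z \<inter> E \<noteq> {}"
  shows "Z \<subseteq> E \<union> components_meeting X E"
proof (rule ccontr)
  assume "\<not> ?thesis"
  then obtain x where x: "x \<in> Z" "x \<notin> E" "x \<notin> components_meeting X E" by auto
  then have xX: "x \<in> X" using in_components_subset[OF Z(1)] by auto
  then have "connected_component_set X x \<inter> E = {}"
    using x componentsI[OF xX] by (auto simp: components_meeting_def connected_component_refl)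
  then obtain Q where Q: "openin (top_of_set X) Q" "closedin (top_of_set X) Q" "x \<in> Q" "Q \<inter> E = {}"
    using clopen_avoiding[OF X E xX] by blast
  have cX: "closed X" using X by (rule compact_imp_closed)
  have 1: "closed Q" using Q(2) cX by (rule closedin_closed_trans)
  have "closedin (top_of_set X) (X - Q)" using Q(1) by (simp add: closedin_diff)
  then have 2: "closed (E \<union> (X - Q))" using cX E closedin_closed_trans by blast
  show False
    using in_components_connected[OF Z(1)] 1 2 in_components_subset[OF Z(1)] Q x Z(2)
    unfolding connected_closed by blast
qed

text \<open>If \<open>E \<union> frontier \<Omega>\<close> separated \<open>a\<close> and \<open>b\<close>, one of its components \<open>Z\<close> would. If \<open>Z\<close> misses \<open>E\<close>, then
  \<open>\<Omega>\<close> itself joins the points outside \<open>Z\<close>; otherwise \<open>Z\<close> is contained in \<open>E\<close> and the boundary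
  components that meet \<open>E\<close>, which do not separate by assumption.\<close>

lemma connected_component_avoiding:
  fixes \<Omega> E :: "ext_complex set"
  assumes \<Omega>: "is_domain \<Omega>" and E: "closed E" and a: "a \<in> \<Omega>" and b: "b \<in> \<Omega>"
    and ab: "connected_component (- (E \<union> components_meeting (frontier \<Omega>) E)) a b"
  shows "connected_component (\<Omega> - E) a b"
proof -
  have op: "open \<Omega>" "connected \<Omega>" using \<Omega> by (auto simp: is_domain_def)
  have dis: "\<Omega> \<inter> frontier \<Omega> = {}" using op by (auto simp: frontier_def interior_open)
  have X: "compact (frontier \<Omega>)" by (simp add: compact_iff_closed_ext)
  have "connected_component (- (E \<union> frontier \<Omega>)) a b"
  proof (rule ccontr)
    assume "\<not> ?thesis"
    moreover have "closed (E \<union> frontier \<Omega>)" using E by auto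
    moreover have "a \<notin> E \<union> frontier \<Omega>" "b \<notin> E \<union> frontier \<Omega>"
      using connected_component_in[OF ab] a b dis by auto
    ultimately obtain Z where Z: "Z \<in> components (E \<union> frontier \<Omega>)" "\<not> connected_component (- Z) a b"
      using separation_by_component_ext by blast
    show False
    proof (cases "Z \<inter> E = {}")
      case True
      then have "\<Omega> \<subseteq> - Z" using in_components_subset[OF Z(1)] dis by auto
      then show False using Z(2) op a b by (metis connected_componentI)
    next
      case False
      then have "Z \<subseteq> E \<union> components_meeting (frontier \<Omega>) E"
        by (rule component_Un_subset[OF X E Z(1)])
      then show False using Z(2) ab by (meson Compl_anti_mono connected_component_of_subset)
    qed
  qed
  then obtain T where T: "connected T" "T \<subseteq> - (E \<union> frontier \<Omega>)" "a \<in> T" "b \<in> T"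
    by (auto simp: connected_component_def)
  have "T \<subseteq> \<Omega>"
    using connected_Int_frontier[of T \<Omega>] T a by auto
  then show ?thesis using T by (intro connected_componentI[of T]) auto
qed

text \<open>The set \<open>K\<close> takes up \<open>E\<close> and the boundary components that meet \<open>E\<close>, except for \<open>X\<^sub>0\<close>, which may be long.
  Janiszewski's theorem applies to \<open>K \<union> C\<close> and \<open>X\<^sub>0\<close>, whose intersection is the connected set \<open>C\<close>; the
  second set does not separate because \<open>\<Omega>\<close> is connected and disjoint from it.\<close>

lemma connected_component_across_component:
  fixes \<Omega> E :: "ext_complex set"
  assumes \<Omega>: "is_domain \<Omega>" and E: "closed E" and a: "a \<in> \<Omega>" and b: "b \<in> \<Omega>"
    and X0: "X\<^sub>0 \<in> components (frontier \<Omega>)"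
    and C: "closed C" "connected C" "C \<subseteq> X\<^sub>0"
    and K: "closed K" "E \<subseteq> K" "K \<inter> X\<^sub>0 \<subseteq> C"
    and Y: "\<And>Y. Y \<in> components (frontier \<Omega>) \<Longrightarrow> Y \<noteq> X\<^sub>0 \<Longrightarrow> Y \<inter> E \<noteq> {} \<Longrightarrow> Y \<subseteq> K"
    and ab: "connected_component (- (K \<union> C)) a b"
  shows "connected_component (\<Omega> - E) a b"
proof (rule connected_component_avoiding[OF \<Omega> E a b])
  have "connected_component (- ((K \<union> C) \<union> X\<^sub>0)) a b"
  proof (rule Janiszewski_ext)
    show "closed (K \<union> C)" using K C by auto
    show "closed X\<^sub>0" using X0 by (rule closed_components[OF frontier_closed])
    have "(K \<union> C) \<inter> X\<^sub>0 = C" using K C by auto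
    then show "connected ((K \<union> C) \<inter> X\<^sub>0)" using C by simp
    have "\<Omega> \<inter> X\<^sub>0 = {}"
      using in_components_subset[OF X0] \<Omega> by (auto simp: is_domain_def frontier_def interior_open)
    then show "connected_component (- X\<^sub>0) a b"
      using \<Omega> a b by (intro connected_componentI[of \<Omega>]) (auto simp: is_domain_def)
  qed (rule ab)
  moreover have "E \<union> components_meeting (frontier \<Omega>) E \<subseteq> (K \<union> C) \<union> X\<^sub>0"
    using K Y by (auto simp: components_meeting_def)
  ultimately show "connected_component (- (E \<union> components_meeting (frontier \<Omega>) E)) a b"
    by (meson Compl_anti_mono connected_component_of_subset)
qed

text \<open>For \<open>Y\<close> in the boundary of \<open>\<Omega>\<close>, this says that \<open>Y\<close> is approached by \<open>\<Omega>\<close> from one side only.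
  For a single point it is local connectedness of \<open>\<Omega>\<close> at that boundary point.\<close>

definition connected_near :: "'a::topological_space set \<Rightarrow> 'a set \<Rightarrow> bool" where
  "connected_near \<Omega> Y \<longleftrightarrow>
     (\<forall>N. open N \<and> Y \<subseteq> N \<longrightarrow>
        (\<exists>V. open V \<and> Y \<subseteq> V \<and> (\<forall>a \<in> V \<inter> \<Omega>. \<forall>b \<in> V \<inter> \<Omega>. connected_component (\<Omega> \<inter> N) a b)))"

text \<open>Boundary components correspond to the ends of \<open>\<Omega>\<close>. With \<open>E = - N\<close>, the boundary components that meet
  \<open>E\<close> form together with \<open>E\<close> a closed set disjoint from \<open>Q\<close>, and the complementary component
  containing \<open>Q\<close> is the required neighbourhood.\<close>

lemma connected_near_component:
  fixes \<Omega> :: "ext_complex set"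
  assumes \<Omega>: "is_domain \<Omega>" and Q: "Q \<in> components (frontier \<Omega>)"
  shows "connected_near \<Omega> Q"
  unfolding connected_near_def
proof (intro allI impI)
  fix N assume N: "open N \<and> Q \<subseteq> N"
  \<comment> \<open>\<open>K\<close> is all that can prevent a connection inside \<open>N\<close>.\<close>
  define K where "K = - N \<union> components_meeting (frontier \<Omega>) (- N)"
  have K: "closed K"
    unfolding K_def using N
    by (intro closed_Un closed_components_meeting) (auto simp: compact_iff_closed_ext)
  have "Y \<inter> Q = {}" if "Y \<in> components (frontier \<Omega>)" "Y \<inter> - N \<noteq> {}" for Y
    using that N Q components_nonoverlap[of Y _ Q] by auto
  then have QK: "Q \<subseteq> - K" using N by (auto simp: K_def components_meeting_def)
  obtain q where q: "q \<in> Q" using in_components_nonempty[OF Q] by auto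
  define V where "V = connected_component_set (- K) q"
  have "open V" unfolding V_def using K by (intro open_component_ext) auto
  moreover have "Q \<subseteq> V"
    unfolding V_def by (rule connected_component_maximal[OF q in_components_connected[OF Q] QK])
  moreover have "connected_component (\<Omega> \<inter> N) a b" if "a \<in> V \<inter> \<Omega>" "b \<in> V \<inter> \<Omega>" for a b
  proof -
    have "connected_component (- K) a b"
      using that unfolding V_def by (auto intro: connected_component_trans connected_component_sym)
    then have "connected_component (\<Omega> - - N) a b"
      using that N unfolding K_def by (intro connected_component_avoiding \<Omega>) auto
    then show ?thesis by (simp add: Diff_Compl)
  qed
  ultimately show "\<exists>V. open V \<and> Q \<subseteq> V \<and> (\<forall>a \<in> V \<inter> \<Omega>. \<forall>b \<in> V \<inter> \<Omega>. connected_component (\<Omega> \<inter> N) a b)"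
    by blast
qed

text \<open>Only finitely many components are large, and those other than \<open>X\<^sub>0\<close> have positive distance from \<open>y\<close>.\<close>

lemma large_components_avoid:
  fixes X :: "ext_complex set"
  assumes X: "closed X" and fin: "\<And>c. c > 0 \<Longrightarrow> finite {K \<in> components X. diameter K > c}"
    and X0: "X\<^sub>0 \<in> components X" "y \<in> X\<^sub>0" and c: "0 < c"
  obtains d where "0 < d"
    "\<And>Y. Y \<in> components X \<Longrightarrow> Y \<noteq> X\<^sub>0 \<Longrightarrow> Y \<inter> cball y d \<noteq> {} \<Longrightarrow> diameter Y \<le> c"
proof -
  define B where "B = \<Union>({K \<in> components X. diameter K > c} - {X\<^sub>0})"
  have "closed B"
    unfolding B_def using fin[OF c] closed_components[OF X] by (intro closed_Union) auto
  moreover have "y \<notin> B"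
    using X0 components_nonoverlap[of _ X X\<^sub>0] by (auto simp: B_def)
  ultimately obtain d where d: "d > 0" "cball y d \<subseteq> - B"
    by (metis ComplI open_Compl open_contains_cball)
  show ?thesis
  proof (rule that[OF d(1)])
    fix Y assume "Y \<in> components X" "Y \<noteq> X\<^sub>0" "Y \<inter> cball y d \<noteq> {}"
    then show "diameter Y \<le> c" using d(2) by (force simp: B_def)
  qed
qed

text \<open>Every boundary component other than \<open>X\<^sub>0\<close> that reaches from outside \<open>ball y e\<close> to a point near \<open>y\<close> is
  large, so close enough to \<open>y\<close> there is none. The hypothesis \<open>nonsep\<close> says that \<open>y\<close> does not
  cut \<open>X\<^sub>0\<close> apart: all of \<open>X\<^sub>0\<close> away from \<open>y\<close> is held together by a connected set \<open>C\<close> avoiding \<open>y\<close>,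
  which serves as the intersection in Janiszewski's theorem.\<close>

lemma connected_near_point:
  fixes \<Omega> :: "ext_complex set"
  assumes \<Omega>: "is_domain \<Omega>"
    and fin: "\<And>c. c > 0 \<Longrightarrow> finite {K \<in> components (frontier \<Omega>). diameter K > c}"
    and X0: "X\<^sub>0 \<in> components (frontier \<Omega>)" and y: "y \<in> X\<^sub>0"
    and nonsep: "\<And>O'. open O' \<Longrightarrow> y \<in> O' \<Longrightarrow> \<exists>C. closed C \<and> connected C \<and> C \<subseteq> X\<^sub>0 - {y} \<and> X\<^sub>0 - O' \<subseteq> C"
  shows "connected_near \<Omega> {y}"
  unfolding connected_near_def
proof (intro allI impI)
  fix N assume N: "open N \<and> {y} \<subseteq> N"
  then obtain e where e: "e > 0" "ball y e \<subseteq> N" by (auto elim: openE)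
  obtain d where d: "d > 0" "\<And>Y. Y \<in> components (frontier \<Omega>) \<Longrightarrow> Y \<noteq> X\<^sub>0 \<Longrightarrow> Y \<inter> cball y d \<noteq> {} \<Longrightarrow> diameter Y \<le> e/2"
    by (rule large_components_avoid[OF frontier_closed fin X0 y, of "e/2"]) (use e in auto)
  \<comment> \<open>A component of diameter at most \<open>e/2\<close> that leaves \<open>ball y e\<close> stays outside \<open>ball y (e/2)\<close>.\<close>
  define \<eta> where "\<eta> = min d (e/2)"
  have \<eta>: "\<eta> > 0" "\<eta> \<le> d" "\<eta> \<le> e/2" using d e by (auto simp: \<eta>_def)
  obtain C where C: "closed C" "connected C" "C \<subseteq> X\<^sub>0 - {y}" "X\<^sub>0 - ball y \<eta> \<subseteq> C"
    using nonsep[of "ball y \<eta>"] \<eta> by auto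
  define V where "V = connected_component_set (- (- ball y \<eta> \<union> C)) y"
  have "open V" unfolding V_def using C by (intro open_component_ext) auto
  moreover have "y \<in> V" unfolding V_def using C \<eta> by (auto simp: connected_component_refl_eq)
  moreover have "connected_component (\<Omega> \<inter> N) a b" if "a \<in> V \<inter> \<Omega>" "b \<in> V \<inter> \<Omega>" for a b
  proof -
    have "connected_component (- (- ball y \<eta> \<union> C)) a b"
      using that unfolding V_def by (auto intro: connected_component_trans connected_component_sym)
    then have "connected_component (\<Omega> - - ball y e) a b"
    proof (rule connected_component_across_component[OF \<Omega> _ _ _ X0 C(1,2), rotated -1])
      show "- ball y e \<subseteq> - ball y \<eta>" using \<eta> e by auto
      fix Y assume Y: "Y \<in> components (frontier \<Omega>)" "Y \<noteq> X\<^sub>0" "Y \<inter> - ball y e \<noteq> {}"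
      show "Y \<subseteq> - ball y \<eta>"
      proof (rule ccontr)
        assume "\<not> Y \<subseteq> - ball y \<eta>"
        then obtain z where z: "z \<in> Y" "dist y z < \<eta>" by auto
        obtain z' where z': "z' \<in> Y" "dist y z' \<ge> e" using Y(3) by (auto simp: not_less)
        have "diameter Y \<le> e/2" using d(2)[OF Y(1,2)] z \<eta> by force
        moreover have "dist z z' \<le> diameter Y"
          by (rule diameter_bounded_bound[OF bounded_ext z(1) z'(1)])
        ultimately show False using z z' \<eta> dist_triangle[of y z' z] by linarith
      qed
    qed (use that C in auto)
    then have "connected_component (\<Omega> \<inter> ball y e) a b" by (simp add: Diff_Compl)
    then show ?thesis using e by (meson connected_component_of_subset Int_mono order_refl)
  qed
  ultimately show "\<exists>V. open V \<and> {y} \<subseteq> V \<and> (\<forall>a \<in> V \<inter> \<Omega>. \<forall>b \<in> V \<inter> \<Omega>. connected_component (\<Omega> \<inter> N) a b)"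
    by blast
qed

section \<open>Generalized Jordan domains and Peano compacta\<close>

lemma diameter_le_ext:
  fixes S :: "ext_complex set"
  assumes "0 \<le> c" "\<And>x y. x \<in> S \<Longrightarrow> y \<in> S \<Longrightarrow> dist x y \<le> c"
  shows "diameter S \<le> c"
proof (rule ccontr)
  assume "\<not> diameter S \<le> c"
  then obtain d where d: "c < d" "d < diameter S" using dense[of c "diameter S"] by auto
  then obtain x y where "x \<in> S" "y \<in> S" "d < dist x y"
    using diameter_lower_bounded[OF bounded_ext, of d S] assms(1) by auto
  then show False using assms(2)[of x y] d by simp
qed

lemma Jordan_curve_nondegenerate:
  assumes "Jordan_curve K" shows "\<exists>x\<in>K. \<exists>y\<in>K. x \<noteq> y"
proof -
  obtain g where g: "simple_path g" "path_image g = K"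
    using assms by (auto simp: Jordan_curve_def)
  have "g 0 \<noteq> g (1/2)"
  proof
    assume "g 0 = g (1/2)"
    then show False
      using simple_path_inj_on[OF g(1)] g(1) unfolding simple_path_def loop_free_def
      by (elim conjE ballE[of _ _ "0::real"] ballE[of _ _ "1/2::real"]) auto
  qed
  moreover have "g 0 \<in> K" "g (1/2) \<in> K" using g(2) by (auto simp: path_image_def)
  ultimately show ?thesis by blast
qed

lemma Jordan_curve_diameter_pos: "Jordan_curve (K :: ext_complex set) \<Longrightarrow> 0 < diameter K"
  by (metis Jordan_curve_nondegenerate bounded_ext diameter_bounded_bound less_le_trans zero_less_dist_iff)

lemma Peano_continuum_sing: "Peano_continuum {p}"
  unfolding Peano_continuum_def
  by (rule exI[of _ "\<lambda>_. p"]) (auto simp: path_def path_image_def)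

lemma Jordan_curve_imp_Peano_continuum: "Jordan_curve K \<Longrightarrow> Peano_continuum K"
  unfolding Jordan_curve_def Peano_continuum_def using simple_path_imp_path by blast

text \<open>A family of nondegenerate sets is null and countable exactly if, for each \<open>c > 0\<close>, only finitely many members
  have diameter greater than \<open>c\<close>; so the definition only adds to the Peano condition that the boundary
  components are points or Jordan curves.\<close>

lemma generalized_Jordan_domain_iff:
  "generalized_Jordan_domain U \<longleftrightarrow> is_domain U \<and> Peano_compactum (frontier U) \<and>
     (\<forall>K \<in> components (frontier U). (\<exists>p. K = {p}) \<or> Jordan_curve K)"
  (is "?L \<longleftrightarrow> ?R")
proof
  define \<J> where "\<J> = {K \<in> components (frontier U). Jordan_curve K}"
  {
    assume L: ?L
    then have alt: "(\<exists>p. K = {p}) \<or> Jordan_curve K" if "K \<in> components (frontier U)" for K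
      using that by (simp add: generalized_Jordan_domain_def)
    have "finite {K \<in> components (frontier U). diameter K > c}" if c: "c > 0" for c
    proof -
      have sub: "{K \<in> components (frontier U). diameter K > c} \<subseteq> {K \<in> \<J>. diameter K > c}"
        using alt c by (fastforce simp: \<J>_def)
      have "null_family \<J>" using L by (simp add: generalized_Jordan_domain_def \<J>_def)
      then have "finite {K \<in> \<J>. diameter K > c}"
        unfolding null_family_def
      proof
        assume "\<exists>J. bij_betw J (UNIV :: nat set) \<J> \<and> (\<lambda>n. diameter (J n)) \<longlonglongrightarrow> 0"
        then obtain J where J: "bij_betw J (UNIV :: nat set) \<J>" "(\<lambda>n. diameter (J n)) \<longlonglongrightarrow> 0" by blast
        then have "eventually (\<lambda>n. diameter (J n) < c) sequentially"
          using c by (intro order_tendstoD)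
        then obtain n0 where n0: "\<And>n. n \<ge> n0 \<Longrightarrow> diameter (J n) < c"
          by (auto simp: eventually_sequentially)
        have "{K \<in> \<J>. diameter K > c} \<subseteq> J ` {..<n0}"
        proof
          fix K assume K: "K \<in> {K \<in> \<J>. diameter K > c}"
          then obtain n where n: "K = J n" using J(1) by (auto simp: bij_betw_def)
          then have "n < n0" using n0[of n] K by (auto simp: not_le[symmetric])
          then show "K \<in> J ` {..<n0}" using n by auto
        qed
        then show ?thesis by (rule finite_subset) simp
      qed simp
      then show ?thesis by (rule finite_subset[OF sub])
    qed
    then show ?R
      using L alt Peano_continuum_sing Jordan_curve_imp_Peano_continuum
      by (auto simp: Peano_compactum_def compact_iff_closed_ext generalized_Jordan_domain_def)
  next
    assume R: ?R
    then have fin: "finite {K \<in> \<J>. diameter K > c}" if "c > 0" for c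
      using that unfolding Peano_compactum_def \<J>_def
      by (elim conjE) (rule finite_subset[of _ "{K \<in> components (frontier U). diameter K > c}"], auto)
    have "\<J> \<subseteq> (\<Union>n. {K \<in> \<J>. diameter K > 1 / real (Suc n)})"
    proof
      fix K assume K: "K \<in> \<J>"
      then have "0 < diameter K" by (simp add: \<J>_def Jordan_curve_diameter_pos)
      then obtain n where "1 / real (Suc n) < diameter K" using nat_approx_posE by metis
      then show "K \<in> (\<Union>n. {K \<in> \<J>. diameter K > 1 / real (Suc n)})" using K by auto
    qed
    moreover have "countable (\<Union>n. {K \<in> \<J>. diameter K > 1 / real (Suc n)})"
      by (intro countable_UN) (auto intro!: countable_finite fin)
    ultimately have count: "countable \<J>" by (rule countable_subset)
    have "null_family \<J>"
    proof (cases "finite \<J>")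
      case False
      then have bij: "bij_betw (from_nat_into \<J>) UNIV \<J>"
        using count by (simp add: bij_betw_from_nat_into)
      have "(\<lambda>n. diameter (from_nat_into \<J> n)) \<longlonglongrightarrow> 0"
      proof (rule LIMSEQ_I)
        fix e :: real assume e: "e > 0"
        have "finite (from_nat_into \<J> -` {K \<in> \<J>. diameter K > e/2})"
          using bij fin[of "e/2"] e by (intro finite_vimageI) (auto simp: bij_betw_def)
        then obtain n0 where n0: "\<And>n. n \<in> from_nat_into \<J> -` {K \<in> \<J>. diameter K > e/2} \<Longrightarrow> n < n0"
          by (metis finite_nat_set_iff_bounded)
        have "norm (diameter (from_nat_into \<J> n) - 0) < e" if "n \<ge> n0" for n
        proof -
          have "from_nat_into \<J> n \<in> \<J>" using bij by (auto simp: bij_betw_def)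
          then have "diameter (from_nat_into \<J> n) \<le> e/2" using n0[of n] that by force
          then show ?thesis using e diameter_ge_0[OF bounded_ext, of "from_nat_into \<J> n"] by simp
        qed
        then show "\<exists>no. \<forall>n\<ge>no. norm (diameter (from_nat_into \<J> n) - 0) < e" by blast
      qed
      then show ?thesis using bij unfolding null_family_def by blast
    qed (simp add: null_family_def)
    then show ?L using R count by (simp add: generalized_Jordan_domain_def \<J>_def)
  }
qed

section \<open>The boundary behaviour of a continuous extension\<close>

locale boundary_extension =
  fixes U \<Omega> :: "ext_complex set" and \<phi> \<psi> \<Phi> :: "ext_complex \<Rightarrow> ext_complex"
  assumes dom_U: "is_domain U" and dom_\<Omega>: "is_domain \<Omega>"
    and hom: "homeomorphism U \<Omega> \<phi> \<psi>"
    and ext: "continuous_extension U \<Omega> \<phi> \<Phi>"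
begin

lemma open_U: "open U" and open_\<Omega>: "open \<Omega>"
  using dom_U dom_\<Omega> by (auto simp: is_domain_def)

lemma cont: "continuous_on (closure U) \<Phi>"
  and maps: "\<Phi> ` closure U \<subseteq> closure \<Omega>"
  and eq: "z \<in> U \<Longrightarrow> \<Phi> z = \<phi> z"
  using ext by (auto simp: continuous_extension_def)

text \<open>If \<open>x\<close> were sent into \<open>\<Omega>\<close>, then applying \<open>\<psi>\<close> to the images of points of \<open>U\<close> tending to \<open>x\<close> would show
  \<open>x \<in> U\<close>.\<close>

lemma frontier_maps:
  assumes "x \<in> frontier U" shows "\<Phi> x \<in> frontier \<Omega>"
proof -
  have x: "x \<in> closure U" "x \<notin> U" using assms open_U by (auto simp: frontier_def interior_open)
  have "\<Phi> x \<notin> \<Omega>"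
  proof
    assume in\<Omega>: "\<Phi> x \<in> \<Omega>"
    obtain u where u: "\<And>n. u n \<in> U" "u \<longlonglongrightarrow> x" using x(1) by (auto simp: closure_sequential)
    have "u n \<in> closure U" for n using u(1) closure_subset by blast
    then have "(\<lambda>n. \<Phi> (u n)) \<longlonglongrightarrow> \<Phi> x"
      using u x(1) by (intro continuous_on_tendsto_compose[OF cont]) auto
    then have lim: "(\<lambda>n. \<phi> (u n)) \<longlonglongrightarrow> \<Phi> x" by (simp add: u eq)
    have "(\<lambda>n. \<psi> (\<phi> (u n))) \<longlonglongrightarrow> \<psi> (\<Phi> x)"
      using hom u in\<Omega> by (intro continuous_on_tendsto_compose[of \<Omega> \<psi>, OF _ lim]) (auto simp: homeomorphism_def)
    then have "u \<longlonglongrightarrow> \<psi> (\<Phi> x)" using hom u by (simp add: homeomorphism_def)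
    then have "x = \<psi> (\<Phi> x)" using u(2) LIMSEQ_unique by blast
    also have "\<dots> \<in> U" using hom in\<Omega> by (auto simp: homeomorphism_def)
    finally show False using x by simp
  qed
  then show ?thesis using maps x open_\<Omega> by (auto simp: frontier_def interior_open)
qed

lemma frontier_preimage:
  assumes "x \<in> closure U" "\<Phi> x \<in> frontier \<Omega>" shows "x \<in> frontier U"
proof -
  have "x \<notin> U" using assms(2) eq[of x] hom open_\<Omega> by (auto simp: frontier_def interior_open homeomorphism_def)
  then show ?thesis using assms(1) open_U by (simp add: frontier_def interior_open)
qed

lemma onto: "\<Phi> ` closure U = closure \<Omega>"
proof
  have "compact (\<Phi> ` closure U)"
    using cont by (intro compact_continuous_image) (auto simp: compact_iff_closed_ext)
  moreover have "\<Omega> \<subseteq> \<Phi> ` closure U"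
  proof
    fix y assume "y \<in> \<Omega>"
    then have "\<psi> y \<in> U" "\<phi> (\<psi> y) = y" using hom by (auto simp: homeomorphism_def)
    then show "y \<in> \<Phi> ` closure U" using eq closure_subset by (metis imageI subsetD)
  qed
  ultimately show "closure \<Omega> \<subseteq> \<Phi> ` closure U"
    by (meson closure_minimal compact_imp_closed)
qed (rule maps)

text \<open>If the preimage of \<open>Y\<close> split into two closed parts with disjoint neighbourhoods, then points of \<open>U\<close> close to
  the two parts would have images that can be joined in \<open>\<Omega>\<close> so close to \<open>Y\<close> that the \<open>\<psi>\<close>-image of the
  connection stays in the union of the two neighbourhoods.\<close>

lemma connected_fibre:
  assumes Y: "closed Y" "Y \<subseteq> frontier \<Omega>" and near: "connected_near \<Omega> Y"
  shows "connected {x \<in> closure U. \<Phi> x \<in> Y}" (is "connected ?F")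
proof (rule ccontr)
  have clF: "closed ?F"
    using continuous_closed_preimage[OF cont closed_closure Y(1)] by (simp add: vimage_def Int_def)
  assume "\<not> connected ?F"
  then obtain A B where AB: "closed A" "closed B" "A \<union> B = ?F" "A \<inter> B = {}" "A \<noteq> {}" "B \<noteq> {}"
    using connected_closed_set[OF clF] by auto
  obtain OA OB where O: "open OA" "open OB" "A \<subseteq> OA" "B \<subseteq> OB" "OA \<inter> OB = {}"
    using t4_space[OF AB(1,2,4)] by metis
  \<comment> \<open>The neighbourhood of \<open>Y\<close> to stay in is the complement of \<open>\<Phi> ` R\<close>.\<close>
  define R where "R = closure U - (OA \<union> OB)"
  have "compact (\<Phi> ` R)"
    using cont O unfolding R_def
    by (intro compact_continuous_image) (auto simp: compact_iff_closed_ext intro: continuous_on_subset)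
  moreover have "Y \<inter> \<Phi> ` R = {}" using AB O by (auto simp: R_def)
  ultimately have "open (- \<Phi> ` R) \<and> Y \<subseteq> - \<Phi> ` R" using compact_imp_closed by blast
  then obtain V where V: "open V" "Y \<subseteq> V"
    "\<And>a b. a \<in> V \<inter> \<Omega> \<Longrightarrow> b \<in> V \<inter> \<Omega> \<Longrightarrow> connected_component (\<Omega> \<inter> - \<Phi> ` R) a b"
    using near unfolding connected_near_def by metis
  have approx: "\<exists>u \<in> U \<inter> W. \<Phi> u \<in> V" if x: "x \<in> ?F" "open W" "x \<in> W" for x W
  proof -
    obtain T where T: "open T" "x \<in> T" "\<And>y. y \<in> closure U \<Longrightarrow> y \<in> T \<Longrightarrow> \<Phi> y \<in> V"
    proof -
      have \<Phi>x: "x \<in> closure U" "\<Phi> x \<in> V" using V(2) x(1) by auto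
      then have "(\<Phi> \<longlongrightarrow> \<Phi> x) (at x within closure U)" using cont by (simp add: continuous_on_def)
      then have "eventually (\<lambda>y. \<Phi> y \<in> V) (at x within closure U)"
        using V(1) \<Phi>x(2) by (rule topological_tendstoD)
      then show ?thesis using that \<Phi>x(2) unfolding eventually_at_topological by metis
    qed
    have "open (T \<inter> W)" "x \<in> T \<inter> W" using T x by auto
    then obtain u where "u \<in> U" "u \<in> T \<inter> W" using x unfolding closure_iff_nhds_not_empty by blast
    then show ?thesis using T closure_subset by blast
  qed
  obtain xa xb where "xa \<in> A" "xb \<in> B" using AB by auto
  then obtain ua ub where u: "ua \<in> U \<inter> OA" "\<Phi> ua \<in> V" "ub \<in> U \<inter> OB" "\<Phi> ub \<in> V"
    using approx[of xa OA] approx[of xb OB] AB(3) O by blast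
  have "\<phi> ` U = \<Omega>" using hom by (simp add: homeomorphism_def)
  then have "connected_component (\<Omega> \<inter> - \<Phi> ` R) (\<phi> ua) (\<phi> ub)"
    using V(3)[of "\<phi> ua" "\<phi> ub"] u by (auto simp: eq)
  then obtain M where M: "connected M" "M \<subseteq> \<Omega> \<inter> - \<Phi> ` R" "\<phi> ua \<in> M" "\<phi> ub \<in> M"
    unfolding connected_component_def by blast
  have "continuous_on M \<psi>"
    using hom M by (metis Int_subset_iff continuous_on_subset homeomorphism_cont2)
  then have "connected (\<psi> ` M)" using M(1) connected_continuous_image by blast
  moreover have M': "\<psi> y \<in> U \<and> \<Phi> (\<psi> y) = y" if "y \<in> M" for y
    using M that hom eq[of "\<psi> y"] by (auto simp: homeomorphism_def)
  have "\<psi> ` M \<subseteq> OA \<union> OB"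
  proof clarify
    fix y assume y: "y \<in> M" "\<psi> y \<notin> OB"
    have "\<psi> y \<notin> R" using M(2) M'[OF y(1)] y(1) by (metis ComplD IntD2 image_eqI subsetD)
    then show "\<psi> y \<in> OA" using M'[OF y(1)] y closure_subset[of U] by (auto simp: R_def)
  qed
  moreover have "ua \<in> \<psi> ` M" "ub \<in> \<psi> ` M"
    using imageI[OF M(3), of \<psi>] imageI[OF M(4), of \<psi>] u hom by (simp_all add: homeomorphism_def)
  ultimately show False
    using O(1,2,5) u unfolding connected_def by blast
qed

text \<open>The preimage of \<open>Q\<close> is connected, and any connected subset of \<open>frontier U\<close> containing it has a
  connected image meeting \<open>Q\<close>, hence contained in \<open>Q\<close>. So \<open>\<Phi>\<close> matches the boundary components of
  \<open>U\<close> and \<open>\<Omega>\<close> bijectively.\<close>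

lemma component_fibre:
  assumes Q: "Q \<in> components (frontier \<Omega>)"
  shows "{x \<in> closure U. \<Phi> x \<in> Q} \<in> components (frontier U)"
    and "\<Phi> ` {x \<in> closure U. \<Phi> x \<in> Q} = Q"
proof -
  let ?F = "{x \<in> closure U. \<Phi> x \<in> Q}"
  have Qs: "Q \<subseteq> frontier \<Omega>" "closed Q" "connected Q" "Q \<noteq> {}"
    using Q closed_components[OF frontier_closed Q] by (auto dest: in_components_subset in_components_connected in_components_nonempty)
  have conn: "connected ?F"
    using Qs by (intro connected_fibre connected_near_component[OF dom_\<Omega> Q]) auto
  have "frontier \<Omega> \<subseteq> closure \<Omega>" by (simp add: frontier_def)
  then show im: "\<Phi> ` ?F = Q" using onto Qs(1) by fastforce
  have F: "?F \<subseteq> frontier U" "?F \<noteq> {}" using frontier_preimage Qs(1,4) im by auto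
  show "?F \<in> components (frontier U)"
    unfolding in_components_maximal
  proof (intro conjI allI impI)
    fix D assume D: "D \<noteq> {} \<and> ?F \<subseteq> D \<and> D \<subseteq> frontier U \<and> connected D"
    have fc: "frontier U \<subseteq> closure U" by (simp add: frontier_def)
    have "connected (\<Phi> ` D)"
      using D cont fc by (meson connected_continuous_image continuous_on_subset)
    moreover have "\<Phi> ` D \<subseteq> frontier \<Omega>" using D frontier_maps by auto
    moreover have "Q \<inter> \<Phi> ` D \<noteq> {}" using D F(2) im Qs(4) by blast
    ultimately have "\<Phi> ` D \<subseteq> Q" by (intro components_maximal[OF Q])
    then show "D = ?F" using D fc by auto
  qed (use conn F in auto)
qed

text \<open>Continuous images of Peano continua are Peano continua. A component of large diameter comes
  from a component of large diameter, by uniform continuity, and different components come from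
  different ones.\<close>

lemma Peano_compactum_image:
  assumes "Peano_compactum (frontier U)" shows "Peano_compactum (frontier \<Omega>)"
  unfolding Peano_compactum_def
proof (intro conjI ballI allI impI)
  show "compact (frontier \<Omega>)" by (simp add: compact_iff_closed_ext)
  let ?F = "\<lambda>Q. {x \<in> closure U. \<Phi> x \<in> Q}"
  fix Q assume Q: "Q \<in> components (frontier \<Omega>)"
  then obtain g where g: "path g" "path_image g = ?F Q"
    using assms component_fibre(1)[OF Q] by (auto simp: Peano_compactum_def Peano_continuum_def)
  then have "path (\<Phi> \<circ> g)" "path_image (\<Phi> \<circ> g) = Q"
    using component_fibre(2)[OF Q] cont
    by (auto intro!: path_continuous_image intro: continuous_on_subset simp: path_image_compose)
  then show "Peano_continuum Q" unfolding Peano_continuum_def by blast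
next
  fix c :: real assume c: "c > 0"
  let ?F = "\<lambda>Q. {x \<in> closure U. \<Phi> x \<in> Q}"
  have "uniformly_continuous_on (closure U) \<Phi>"
    using cont by (intro compact_uniformly_continuous) (auto simp: compact_iff_closed_ext)
  then obtain d where d: "d > 0" "\<And>x y. x \<in> closure U \<Longrightarrow> y \<in> closure U \<Longrightarrow> dist x y < d \<Longrightarrow> dist (\<Phi> x) (\<Phi> y) < c"
    using c unfolding uniformly_continuous_on_def by (metis dist_commute)
  have "?F ` {Q \<in> components (frontier \<Omega>). diameter Q > c} \<subseteq> {P \<in> components (frontier U). diameter P > d/2}"
  proof clarify
    fix Q assume Q: "Q \<in> components (frontier \<Omega>)" "c < diameter Q"
    then obtain y z where yz: "y \<in> Q" "z \<in> Q" "c < dist y z"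
      using diameter_lower_bounded[OF bounded_ext c, of Q] by auto
    then obtain y' z' where y': "y' \<in> ?F Q" "z' \<in> ?F Q" "y = \<Phi> y'" "z = \<Phi> z'"
      using component_fibre(2)[OF Q(1)] by blast
    then have "dist y' z' \<ge> d" using d(2)[of y' z'] yz by force
    then have "diameter (?F Q) \<ge> d"
      using diameter_bounded_bound[OF bounded_ext y'(1,2)] by linarith
    then show "?F Q \<in> components (frontier U) \<and> d/2 < diameter (?F Q)"
      using component_fibre(1)[OF Q(1)] d by auto
  qed
  moreover have "finite {P \<in> components (frontier U). diameter P > d/2}"
    using assms half_gt_zero[OF d(1)] unfolding Peano_compactum_def by blast
  ultimately have "finite (?F ` {Q \<in> components (frontier \<Omega>). diameter Q > c})"
    by (rule finite_subset)
  moreover have "inj_on ?F {Q \<in> components (frontier \<Omega>). diameter Q > c}"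
    using component_fibre(2) by (intro inj_on_inverseI[of _ "(`) \<Phi>"]) auto
  ultimately show "finite {Q \<in> components (frontier \<Omega>). diameter Q > c}"
    by (rule finite_imageD)
qed

lemma oscillation_tendsto_0: "((\<lambda>r. oscillation \<phi> U z r) \<longlongrightarrow> 0) (at_right 0)"
proof (rule tendstoI)
  fix e :: real assume e: "e > 0"
  have "uniformly_continuous_on (closure U) \<Phi>"
    using cont by (intro compact_uniformly_continuous) (auto simp: compact_iff_closed_ext)
  then obtain d where d: "d > 0" "\<And>x y. x \<in> closure U \<Longrightarrow> y \<in> closure U \<Longrightarrow> dist x y < d \<Longrightarrow> dist (\<Phi> x) (\<Phi> y) < e/2"
    using e unfolding uniformly_continuous_on_def by (metis half_gt_zero)
  have "dist (oscillation \<phi> U z r) 0 < e" if r: "0 < r" "r < d/2" for r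
  proof -
    have "diameter (\<phi> ` (sphere z r \<inter> U)) \<le> e/2"
    proof (rule diameter_le_ext)
      fix a b assume "a \<in> \<phi> ` (sphere z r \<inter> U)" "b \<in> \<phi> ` (sphere z r \<inter> U)"
      then obtain x y where xy: "a = \<phi> x" "b = \<phi> y" "x \<in> U" "y \<in> U" "dist z x = r" "dist z y = r" by auto
      then have "dist x y < d" using r dist_triangle3[of x y z] by simp
      then have "dist (\<Phi> x) (\<Phi> y) < e/2" using d(2)[of x y] xy closure_subset by blast
      then show "dist a b \<le> e/2" using xy eq by simp
    qed (use e in simp)
    then show ?thesis
      using e diameter_ge_0[OF bounded_ext, of "\<phi> ` (sphere z r \<inter> U)"] by (simp add: oscillation_def)
  qed
  then show "eventually (\<lambda>r. dist (oscillation \<phi> U z r) 0 < e) (at_right 0)"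
    using d(1) by (auto simp: eventually_at_right_field intro!: exI[of _ "d/2"])
qed

lemma Liminf_oscillation: "Liminf (at_right 0) (\<lambda>r. ereal (oscillation \<phi> U z r)) = 0"
  using oscillation_tendsto_0[of z] by (intro lim_imp_Liminf) (auto simp: zero_ereal_def)

end

section \<open>Existence of the extension\<close>

text \<open>Take the component of \<open>w\<close> in the part of \<open>X\<close> close to \<open>w\<close>. If points \<open>g (t n)\<close> outside it converged to
  \<open>w\<close>, then along a subsequence \<open>t n\<close> would converge to a parameter of \<open>w\<close>, and the path would join
  \<open>w\<close> to \<open>g (t n)\<close> without leaving the neighbourhood.\<close>

lemma Peano_continuum_connected_nbhd:
  fixes X :: "'a::metric_space set"
  assumes "Peano_continuum X" and w: "w \<in> X" and O': "open O'" "w \<in> O'"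
  obtains C d where "closed C" "connected C" "C \<subseteq> X \<inter> O'" "0 < d" "X \<inter> ball w d \<subseteq> C"
proof -
  obtain g where g: "path g" "path_image g = X" using assms(1) by (auto simp: Peano_continuum_def)
  have cont: "continuous_on {0..1} g" using g(1) by (simp add: path_def)
  obtain e where e: "e > 0" "cball w e \<subseteq> O'" using O' open_contains_cball by blast
  define C where "C = connected_component_set (X \<inter> cball w e) w"
  have "closed X" using g compact_path_image compact_imp_closed by blast
  then have "closed C" unfolding C_def by (intro closed_connected_component) auto
  moreover have "connected C" by (simp add: C_def)
  moreover have "C \<subseteq> X \<inter> O'" using connected_component_subset[of "X \<inter> cball w e" w] e by (auto simp: C_def)
  moreover have "\<exists>d>0. X \<inter> ball w d \<subseteq> C"
  proof (rule ccontr)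
    assume neg: "\<not> ?thesis"
    have "\<exists>t\<in>{0..1}. g t \<in> ball w (1 / real (Suc n)) - C" for n
    proof -
      have "\<not> X \<inter> ball w (1 / real (Suc n)) \<subseteq> C" using neg by simp
      then show ?thesis using g(2) by (auto simp: path_image_def)
    qed
    then obtain t where t: "\<And>n. t n \<in> {0..1}" "\<And>n. g (t n) \<in> ball w (1 / real (Suc n)) - C" by metis
    obtain t0 s where s: "t0 \<in> {0..1}" "strict_mono s" "(t \<circ> s) \<longlonglongrightarrow> t0"
      using compact_Icc[of "0::real" 1] t(1) unfolding compact_def by blast
    have "(\<lambda>n. g ((t \<circ> s) n)) \<longlonglongrightarrow> g t0"
      using t(1) by (intro continuous_on_tendsto_compose[OF cont s(3) s(1)]) auto
    moreover have "(\<lambda>n. g (t n)) \<longlonglongrightarrow> w"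
    proof (rule metric_LIMSEQ_I)
      fix r :: real assume "r > 0"
      then obtain N where N: "1 / real (Suc N) < r" using nat_approx_posE by metis
      have "dist (g (t n)) w < r" if "n \<ge> N" for n
      proof -
        have "1 / real (Suc n) \<le> 1 / real (Suc N)" using that by (simp add: frac_le)
        then show ?thesis using t(2)[of n] N by (auto simp: dist_commute)
      qed
      then show "\<exists>no. \<forall>n\<ge>no. dist (g (t n)) w < r" by blast
    qed
    then have "(\<lambda>n. g ((t \<circ> s) n)) \<longlonglongrightarrow> w"
      using LIMSEQ_subseq_LIMSEQ[OF _ s(2)] by (simp add: o_def)
    ultimately have gt0: "g t0 = w" by (rule LIMSEQ_unique)
    obtain d where d: "d > 0" "\<And>u. u \<in> {0..1} \<Longrightarrow> dist u t0 < d \<Longrightarrow> dist (g u) w < e"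
      using cont s(1) e(1) gt0 unfolding continuous_on_iff by metis
    obtain n where n: "dist (t (s n)) t0 < d"
      using metric_LIMSEQ_D[OF s(3) d(1)] by auto
    have sub: "closed_segment t0 (t (s n)) \<subseteq> {0..1}"
      using s(1) t(1)[of "s n"] by (intro closed_segment_subset) auto
    have "connected (g ` closed_segment t0 (t (s n)))"
      using cont sub by (intro connected_continuous_image continuous_on_subset[OF cont sub]) auto
    moreover have "g ` closed_segment t0 (t (s n)) \<subseteq> X \<inter> cball w e"
    proof clarify
      fix u assume u: "u \<in> closed_segment t0 (t (s n))"
      then have "dist u t0 \<le> dist (t (s n)) t0"
        by (metis dist_commute segment_bound(1) dist_norm)
      then show "g u \<in> X \<inter> cball w e"
        using u sub d(2)[of u] n g(2) by (auto simp: path_image_def dist_commute less_imp_le)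
    qed
    moreover have "w \<in> g ` closed_segment t0 (t (s n))" using gt0 by blast
    ultimately have "g ` closed_segment t0 (t (s n)) \<subseteq> C"
      unfolding C_def by (intro connected_component_maximal)
    then show False using t(2)[of "s n"] by auto
  qed
  ultimately show ?thesis using that by blast
qed

lemma continuous_on_closure_of_limits:
  fixes f g :: "'a::metric_space \<Rightarrow> 'b::metric_space"
  assumes lim: "\<And>z. z \<in> closure U \<Longrightarrow> (f \<longlongrightarrow> g z) (at z within U)"
    and eq: "\<And>z. z \<in> U \<Longrightarrow> g z = f z"
  shows "continuous_on (closure U) g"
  unfolding continuous_on_iff
proof (intro ballI allI impI)
  have near: "\<exists>d>0. \<forall>u\<in>U. dist u z < d \<longrightarrow> dist (f u) (g z) < e" if zc: "z \<in> closure U" and e0: "e > 0" for z e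
  proof -
    obtain d where "d > 0" "\<And>u. u \<in> U \<Longrightarrow> 0 < dist u z \<Longrightarrow> dist u z < d \<Longrightarrow> dist (f u) (g z) < e"
      using tendstoD[OF lim[OF zc] e0] unfolding eventually_at by (metis zero_less_dist_iff)
    moreover have "dist (f z) (g z) < e" if "z \<in> U" using eq[OF that] e0 by simp
    ultimately show ?thesis by (metis zero_less_dist_iff)
  qed
  fix z and e :: real assume z: "z \<in> closure U" and e: "e > 0"
  obtain d where d: "d > 0" "\<And>u. u \<in> U \<Longrightarrow> dist u z < d \<Longrightarrow> dist (f u) (g z) < e/2"
    using near[OF z, of "e/2"] e by auto
  have "dist (g y) (g z) < e" if y: "y \<in> closure U" "dist y z < d" for y
  proof -
    obtain d' where d': "d' > 0" "\<And>u. u \<in> U \<Longrightarrow> dist u y < d' \<Longrightarrow> dist (f u) (g y) < e/2"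
      using near[OF y(1), of "e/2"] e by auto
    obtain u where u: "u \<in> U" "dist u y < min d' (d - dist y z)"
      using y d' unfolding closure_approachable by (metis diff_gt_0_iff_gt min_less_iff_conj)
    then have "dist u z < d" using dist_triangle[of u z y] by linarith
    then show ?thesis using u d d' dist_triangle_half_r[of "f u" "g y" e "g z"] by auto
  qed
  then show "\<exists>d>0. \<forall>x'\<in>closure U. dist x' z < d \<longrightarrow> dist (g x') (g z) < e" using d(1) by blast
qed

lemma sphere_meets_connected:
  fixes U :: "'a::metric_space set"
  assumes "connected U" "x \<in> U" "y \<in> U" "dist z x < r" "r < dist z y"
  shows "\<exists>u\<in>U. dist z u = r"
proof -
  have "connected (dist z ` U)"
    using assms(1) by (intro connected_continuous_image continuous_intros)
  then have "{dist z x..dist z y} \<subseteq> dist z ` U"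
    using assms by (intro connected_contains_Icc) auto
  moreover have "r \<in> {dist z x..dist z y}" using assms by simp
  ultimately show ?thesis by blast
qed

lemma small_oscillation_radius:
  assumes lim: "Liminf (at_right 0) (\<lambda>r. ereal (oscillation \<phi> U z r)) = 0" and e: "e > 0" and d: "d > 0"
  shows "\<exists>r. 0 < r \<and> r < d \<and> oscillation \<phi> U z r < e"
proof (rule ccontr)
  assume "\<not> ?thesis"
  then have "oscillation \<phi> U z r \<ge> e" if "0 < r" "r < d" for r
    using that not_le by blast
  then have "eventually (\<lambda>r. ereal e \<le> ereal (oscillation \<phi> U z r)) (at_right 0)"
    unfolding eventually_at_right_field using d by (intro exI[of _ d]) auto
  then have "ereal e \<le> 0" using Liminf_bounded lim by metis
  then show False using e by (simp add: zero_ereal_def)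
qed

text \<open>The limit \<open>w\<close> is a cluster point of the images of the circles with small oscillation. Once the image
  of such a circle is close enough to \<open>w\<close>, every point inside the circle has its image in the
  neighbourhood \<open>O'\<close> of \<open>w\<close>: otherwise that image could be joined in \<open>\<Omega>\<close> to \<open>\<phi> x0\<close> avoiding the
  image of the circle, although \<open>x0\<close> lies outside the circle.\<close>

theorem limit_at_boundary_point:
  fixes U \<Omega> :: "ext_complex set"
  assumes dom_U: "is_domain U" and dom_\<Omega>: "is_domain \<Omega>" and hom: "homeomorphism U \<Omega> \<phi> \<psi>"
    and Peano: "Peano_compactum (frontier \<Omega>)" and z: "z \<in> frontier U"
    and osc: "Liminf (at_right 0) (\<lambda>r. ereal (oscillation \<phi> U z r)) = 0"
  shows "\<exists>w. (\<phi> \<longlongrightarrow> w) (at z within U)"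
proof -
  have U: "open U" "connected U" and \<Omega>: "open \<Omega>" "connected \<Omega>"
    using dom_U dom_\<Omega> by (auto simp: is_domain_def)
  have zU: "z \<in> closure U" "z \<notin> U" using z U by (auto simp: frontier_def interior_open)
  then obtain x0 where x0: "x0 \<in> U" by fastforce
  define r0 where "r0 = dist z x0"
  have r0: "r0 > 0" using x0 zU by (auto simp: r0_def)
  have "\<exists>r. 0 < r \<and> r < min r0 (1 / real (Suc n)) \<and> oscillation \<phi> U z r < 1 / real (Suc n)" for n
    using r0 by (intro small_oscillation_radius[OF osc, of "1 / real (Suc n)" "min r0 (1 / real (Suc n))"]) auto
  then obtain r where r: "\<And>n. 0 < r n" "\<And>n. r n < r0" "\<And>n. r n < 1 / real (Suc n)"
      "\<And>n. oscillation \<phi> U z (r n) < 1 / real (Suc n)"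
    unfolding min_less_iff_conj by metis
  have "\<exists>u\<in>U. dist z u = r n" for n
  proof -
    obtain x where "x \<in> U" "dist x z < r n" using zU(1) r(1)[of n] unfolding closure_approachable by blast
    then show ?thesis
      using sphere_meets_connected[OF U(2) _ x0, of x z "r n"] r(2)[of n] by (simp add: r0_def dist_commute)
  qed
  then obtain u where u: "\<And>n. u n \<in> U" "\<And>n. dist z (u n) = r n" by metis
  have inv: "\<phi> x \<in> \<Omega>" "\<psi> (\<phi> x) = x" if "x \<in> U" for x using hom that by (auto simp: homeomorphism_def)
  have lim0: "(\<lambda>n. 1 / real (Suc n)) \<longlonglongrightarrow> 0" by (rule LIMSEQ_Suc[OF lim_1_over_n])
  have uz: "u \<longlonglongrightarrow> z"
    unfolding tendsto_dist_iff[of u]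
    by (rule tendsto_sandwich[OF _ _ tendsto_const lim0])
       (use u(2) r(1,3) in \<open>auto intro!: always_eventually less_imp_le simp: dist_commute\<close>)
  obtain w s where s: "strict_mono s" "((\<lambda>n. \<phi> (u n)) \<circ> s) \<longlonglongrightarrow> w"
    using compact_UNIV_ext unfolding compact_def by (metis UNIV_I)
  have us: "(\<lambda>n. u (s n)) \<longlonglongrightarrow> z" using LIMSEQ_subseq_LIMSEQ[OF uz s(1)] by (simp add: o_def)
  have "w \<in> closure \<Omega>" unfolding closure_sequential
    using s(2) inv(1) u(1) by (intro exI[of _ "(\<lambda>n. \<phi> (u n)) \<circ> s"]) auto
  moreover have "w \<notin> \<Omega>"
  proof
    assume "w \<in> \<Omega>"
    then have "(\<lambda>n. \<psi> (((\<lambda>n. \<phi> (u n)) \<circ> s) n)) \<longlonglongrightarrow> \<psi> w"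
      using hom inv u by (intro continuous_on_tendsto_compose[of \<Omega> \<psi>, OF _ s(2)]) (auto simp: homeomorphism_def)
    then have "(\<lambda>n. u (s n)) \<longlonglongrightarrow> \<psi> w" using inv u by (simp add: o_def)
    then have "z = \<psi> w" using us LIMSEQ_unique by blast
    also have "\<psi> w \<in> U" using hom \<open>w \<in> \<Omega>\<close> by (auto simp: homeomorphism_def)
    finally show False using zU by simp
  qed
  ultimately have w: "w \<in> frontier \<Omega>" using \<Omega> by (simp add: frontier_def interior_open)
  define X0 where "X0 = connected_component_set (frontier \<Omega>) w"
  have X0: "X0 \<in> components (frontier \<Omega>)" "w \<in> X0"
    using w by (auto simp: X0_def componentsI connected_component_refl)
  have PX0: "Peano_continuum X0" and fin: "\<And>c. c > 0 \<Longrightarrow> finite {K \<in> components (frontier \<Omega>). diameter K > c}"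
    using Peano X0 by (auto simp: Peano_compactum_def)
  have "\<exists>R>0. \<forall>x\<in>U. dist x z < R \<longrightarrow> dist (\<phi> x) w < e" if e: "e > 0" for e
  proof -
    have "dist w (\<phi> x0) > 0" using inv(1)[OF x0] \<open>w \<notin> \<Omega>\<close> by auto
    then obtain O' where O': "open O'" "w \<in> O'" "O' \<subseteq> ball w (min e (dist w (\<phi> x0)))" "connected (- O')"
      using small_nbhd_connected_complement[of "min e (dist w (\<phi> x0))" w] e by (metis min_less_iff_conj)
    obtain C d1 where C: "closed C" "connected C" "C \<subseteq> X0 \<inter> O'" "0 < d1" "X0 \<inter> ball w d1 \<subseteq> C"
      by (rule Peano_continuum_connected_nbhd[OF PX0 X0(2) O'(1,2)])
    obtain d2 where d2: "d2 > 0" "cball w d2 \<subseteq> O'" using O' open_contains_cball by blast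
    \<comment> \<open>\<open>cball w \<eta>\<close> lies in \<open>O'\<close> and meets \<open>X0\<close> only inside \<open>C\<close>; it will contain \<open>E\<close> and the small components meeting \<open>E\<close>.\<close>
    define \<eta> where "\<eta> = min (d1/2) d2"
    have \<eta>: "\<eta> > 0" "\<eta> < d1" "\<eta> \<le> d2" using C(4) d2 by (auto simp: \<eta>_def)
    obtain d where d: "d > 0" "\<And>Y. Y \<in> components (frontier \<Omega>) \<Longrightarrow> Y \<noteq> X0 \<Longrightarrow> Y \<inter> cball w d \<noteq> {} \<Longrightarrow> diameter Y \<le> \<eta>/2"
      by (rule large_components_avoid[OF frontier_closed fin X0, of "\<eta>/2"]) (use \<eta> in auto)
    define \<eta>' where "\<eta>' = min (\<eta>/2) d"
    have \<eta>': "\<eta>' > 0" "\<eta>' \<le> \<eta>/2" "\<eta>' \<le> d" using \<eta> d by (auto simp: \<eta>'_def)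
    have "eventually (\<lambda>n. dist (\<phi> (u (s n))) w < \<eta>'/2) sequentially"
      using tendstoD[OF s(2), of "\<eta>'/2"] \<eta>' by simp
    moreover have "eventually (\<lambda>n. 1 / real (Suc (s n)) < \<eta>'/2) sequentially"
      using order_tendstoD(2)[OF LIMSEQ_subseq_LIMSEQ[OF lim0 s(1)], of "\<eta>'/2"] \<eta>' by (simp add: o_def)
    ultimately obtain n where n: "dist (\<phi> (u (s n))) w < \<eta>'/2" "1 / real (Suc (s n)) < \<eta>'/2"
      using eventually_happens[OF eventually_conj] trivial_limit_sequentially by blast
    define R where "R = r (s n)"
    define E where "E = closure (\<phi> ` (sphere z R \<inter> U))"
    have "\<phi> ` (sphere z R \<inter> U) \<subseteq> cball w \<eta>'"
    proof clarify
      fix x assume x: "x \<in> sphere z R" "x \<in> U"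
      have "dist (\<phi> x) (\<phi> (u (s n))) \<le> diameter (\<phi> ` (sphere z R \<inter> U))"
        using x u by (intro diameter_bounded_bound[OF bounded_ext]) (auto simp: R_def)
      also have "\<dots> < \<eta>'/2" using r(4)[of "s n"] n(2) by (simp add: oscillation_def R_def)
      finally show "\<phi> x \<in> cball w \<eta>'"
        using n(1) dist_triangle[of w "\<phi> x" "\<phi> (u (s n))"] by (simp add: dist_commute)
    qed
    then have E: "closed E" "E \<subseteq> cball w \<eta>'" unfolding E_def by (simp_all add: closure_minimal)
    have "\<phi> x \<in> O'" if x: "x \<in> U" "dist x z < R" for x
    proof (rule ccontr)
      assume nO: "\<phi> x \<notin> O'"
      have "\<phi> x0 \<notin> O'" using O'(3) by auto
      then have "connected_component (- (cball w \<eta> \<union> C)) (\<phi> x) (\<phi> x0)"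
        using O'(4) nO d2 \<eta> C by (intro connected_componentI[of "- O'"]) auto
      then have "connected_component (\<Omega> - E) (\<phi> x) (\<phi> x0)"
      proof (rule connected_component_across_component[OF dom_\<Omega> E(1) inv(1)[OF x(1)] inv(1)[OF x0] X0(1) C(1,2), rotated -1])
        show "E \<subseteq> cball w \<eta>" using E(2) \<eta>' \<eta> by auto
        show "cball w \<eta> \<inter> X0 \<subseteq> C" using C(5) \<eta> by auto
        fix Y assume Y: "Y \<in> components (frontier \<Omega>)" "Y \<noteq> X0" "Y \<inter> E \<noteq> {}"
        then obtain y where "y \<in> Y" "y \<in> E" by blast
        then have y: "y \<in> Y" "dist w y \<le> \<eta>'" using E(2) by auto
        then have "diameter Y \<le> \<eta>/2" using d(2)[OF Y(1,2)] \<eta>' by force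
        then have "dist y y' \<le> \<eta>/2" if "y' \<in> Y" for y'
          using diameter_bounded_bound[OF bounded_ext y(1) that] by linarith
        then have "dist w y' \<le> \<eta>" if "y' \<in> Y" for y'
          using that y(2) \<eta>'(2) dist_triangle[of w y' y] by fastforce
        then show "Y \<subseteq> cball w \<eta>" by auto
      qed (use C in auto)
      then obtain T where T: "connected T" "T \<subseteq> \<Omega> - E" "\<phi> x \<in> T" "\<phi> x0 \<in> T"
        unfolding connected_component_def by blast
      have "continuous_on T \<psi>" using hom T(2) by (metis Diff_subset continuous_on_subset homeomorphism_cont2 subset_trans)
      then have "connected (\<psi> ` T)" using T(1) by (rule connected_continuous_image)
      moreover have "x \<in> \<psi> ` T" "x0 \<in> \<psi> ` T"
        using imageI[OF T(3), of \<psi>] imageI[OF T(4), of \<psi>] inv(2) x x0 by simp_all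
      moreover have "dist z x < R" "R < dist z x0"
        using x(2) r(2)[of "s n"] by (simp_all add: R_def r0_def dist_commute)
      ultimately obtain v where v: "v \<in> \<psi> ` T" "dist z v = R"
        using sphere_meets_connected[of "\<psi> ` T" x x0 z R] by blast
      then obtain t where t: "t \<in> T" "v = \<psi> t" by blast
      then have "v \<in> U" "\<phi> v = t" using hom T(2) by (auto simp: homeomorphism_def)
      then have "t \<in> \<phi> ` (sphere z R \<inter> U)" using v by auto
      then have "t \<in> E" unfolding E_def by (rule subsetD[OF closure_subset])
      then show False using T(2) t by auto
    qed
    then have "\<phi> x \<in> ball w (min e (dist w (\<phi> x0)))" if "x \<in> U" "dist x z < R" for x
      using O'(3) that by blast
    then have "\<forall>x\<in>U. dist x z < R \<longrightarrow> dist (\<phi> x) w < e"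
      by (simp add: dist_commute[of w])
    moreover have "R > 0" using r(1) by (simp add: R_def)
    ultimately show ?thesis by blast
  qed
  then have "(\<phi> \<longlongrightarrow> w) (at z within U)"
    unfolding tendsto_iff eventually_at by blast
  then show ?thesis by blast
qed

theorem extension_of_small_oscillation:
  fixes U \<Omega> :: "ext_complex set"
  assumes dom_U: "is_domain U" and dom_\<Omega>: "is_domain \<Omega>" and hom: "homeomorphism U \<Omega> \<phi> \<psi>"
    and Peano: "Peano_compactum (frontier \<Omega>)"
    and osc: "\<And>z. z \<in> frontier U \<Longrightarrow> Liminf (at_right 0) (\<lambda>r. ereal (oscillation \<phi> U z r)) = 0"
  shows "\<exists>\<Phi>. continuous_extension U \<Omega> \<phi> \<Phi>"
proof -
  have U: "open U" using dom_U by (simp add: is_domain_def)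
  obtain L where L: "\<And>z. z \<in> frontier U \<Longrightarrow> (\<phi> \<longlongrightarrow> L z) (at z within U)"
    using limit_at_boundary_point[OF dom_U dom_\<Omega> hom Peano _ osc] by metis
  define \<Phi> where "\<Phi> z = (if z \<in> U then \<phi> z else L z)" for z
  have cont: "continuous_on (closure U) \<Phi>"
  proof (rule continuous_on_closure_of_limits[of U \<phi>])
    fix z assume "z \<in> closure U"
    then show "(\<phi> \<longlongrightarrow> \<Phi> z) (at z within U)"
      using L[of z] hom U by (auto simp: \<Phi>_def frontier_def interior_open homeomorphism_def continuous_on_def)
  qed (simp add: \<Phi>_def)
  have "\<Phi> ` U \<subseteq> closure \<Omega>" using hom closure_subset[of \<Omega>] by (simp add: \<Phi>_def homeomorphism_def)
  then have "\<Phi> ` closure U \<subseteq> closure \<Omega>" using image_closure_subset[OF cont closed_closure] by blast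
  moreover have "\<Phi> x = \<phi> x" if "x \<in> U" for x using that by (simp add: \<Phi>_def)
  ultimately show ?thesis using cont unfolding continuous_extension_def by blast
qed

section \<open>Arcs and monotone images of Jordan curves\<close>

text \<open>The corresponding result for normed spaces is applied to the unit sphere.\<close>

lemma path_contains_arc_ext:
  fixes p :: "real \<Rightarrow> ext_complex"
  assumes p: "path p" and ne: "pathstart p \<noteq> pathfinish p"
  obtains q where "arc q" "path_image q \<subseteq> path_image p" "pathstart q = pathstart p" "pathfinish q = pathfinish p"
proof -
  have cont: "continuous_on UNIV stereo" "continuous_on (sphere 0 1) (inv stereo)"
    and inv: "inv stereo (stereo x) = x" and sph: "stereo x \<in> sphere 0 1" for x
    using homeomorphism_stereo by (auto simp: homeomorphism_def)
  have "path (stereo \<circ> p)" using p cont by (meson continuous_on_subset path_continuous_image subset_UNIV)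
  moreover have "pathstart (stereo \<circ> p) \<noteq> pathfinish (stereo \<circ> p)"
    using ne by (metis inv pathstart_compose pathfinish_compose)
  ultimately obtain q where q: "arc q" "path_image q \<subseteq> path_image (stereo \<circ> p)"
      "pathstart q = pathstart (stereo \<circ> p)" "pathfinish q = pathfinish (stereo \<circ> p)"
    using path_contains_arc[of "stereo \<circ> p"] by metis
  have im: "path_image q \<subseteq> stereo ` path_image p" using q(2) by (simp add: path_image_compose)
  then have sq: "path_image q \<subseteq> sphere 0 1" using sph by blast
  have "path (inv stereo \<circ> q)"
    using q(1) cont(2) sq by (intro path_continuous_image) (auto simp: arc_def intro: continuous_on_subset)
  moreover have "inj_on (inv stereo \<circ> q) {0..1}"
  proof (rule comp_inj_on)
    show "inj_on q {0..1}" using q(1) by (simp add: arc_def)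
    have "stereo (inv stereo v) = v" if "v \<in> q ` {0..1}" for v
      using that sq homeomorphism_stereo by (auto simp: homeomorphism_def path_image_def)
    then show "inj_on (inv stereo) (q ` {0..1})" by (rule inj_on_inverseI)
  qed
  ultimately have "arc (inv stereo \<circ> q)" by (simp add: arc_def)
  moreover have "path_image (inv stereo \<circ> q) \<subseteq> path_image p"
    using im inv by (force simp: path_image_compose)
  moreover have "pathstart (inv stereo \<circ> q) = pathstart p" "pathfinish (inv stereo \<circ> q) = pathfinish p"
    using q(3,4) inv by (simp_all add: pathstart_compose pathfinish_compose)
  ultimately show ?thesis using that by blast
qed

text \<open>An arc from \<open>h a\<close> to \<open>h b\<close> inside the image must pass through every point \<open>h x\<close> of it: monotonicity makes
  \<open>h x\<close> the only common point of the images of \<open>{a..x}\<close> and \<open>{x..b}\<close>.\<close>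

lemma monotone_image_arc:
  fixes h :: "real \<Rightarrow> ext_complex"
  assumes cont: "continuous_on {a..b} h" and ab: "a \<le> b" and ne: "h a \<noteq> h b"
    and fib: "\<And>y. connected {x \<in> {a..b}. h x = y}"
  obtains q where "arc q" "path_image q = h ` {a..b}" "pathstart q = h a" "pathfinish q = h b"
proof -
  define l where "l x = (b - a) * x + a" for x :: real
  have lim: "l ` {0..1} = {a..b}"
    using image_affinity_atLeastAtMost[of "b - a" a 0 1] ab by (simp add: l_def[abs_def])
  have "continuous_on {0..1} l" unfolding l_def by (intro continuous_intros)
  then have "path (h \<circ> l)" unfolding path_def using cont lim by (intro continuous_on_compose) auto
  moreover have im: "path_image (h \<circ> l) = h ` {a..b}" using lim by (metis image_comp path_image_def)
  moreover have st: "pathstart (h \<circ> l) = h a" "pathfinish (h \<circ> l) = h b"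
    by (simp_all add: pathstart_def pathfinish_def l_def)
  ultimately obtain q where q: "arc q" "path_image q \<subseteq> h ` {a..b}" "pathstart q = h a" "pathfinish q = h b"
    using path_contains_arc_ext[of "h \<circ> l"] ne by metis
  have "h ` {a..b} \<subseteq> path_image q"
  proof (rule ccontr)
    assume "\<not> ?thesis"
    then obtain x where x: "x \<in> {a..b}" "h x \<notin> path_image q" by blast
    have cl: "closed (h ` {a..x})" "closed (h ` {x..b})"
      using x(1) by (auto intro!: compact_imp_closed compact_continuous_image continuous_on_subset[OF cont])
    have int: "y = h x" if y: "y \<in> h ` {a..x}" "y \<in> h ` {x..b}" for y
    proof -
      obtain s t where st: "s \<in> {a..x}" "t \<in> {x..b}" "h s = y" "h t = y" using y by auto
      then have "s \<in> {x \<in> {a..b}. h x = y}" "t \<in> {x \<in> {a..b}. h x = y}" using x(1) by auto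
      then have "{s..t} \<subseteq> {x \<in> {a..b}. h x = y}" by (rule connected_contains_Icc[OF fib])
      then show ?thesis using st by auto
    qed
    have un: "path_image q \<subseteq> h ` {a..x} \<union> h ` {x..b}"
      using q(2) x(1) by (metis atLeastAtMost_iff image_Un ivl_disj_un_two_touch(4))
    have "h a \<in> path_image q" "h b \<in> path_image q"
      using q(3,4) pathstart_in_path_image[of q] pathfinish_in_path_image[of q] by simp_all
    moreover have "h a \<in> h ` {a..x}" "h b \<in> h ` {x..b}" using x(1) by auto
    moreover have "connected (path_image q)" using q(1) by (simp add: arc_imp_path connected_path_image)
    moreover have "h ` {a..x} \<inter> h ` {x..b} \<inter> path_image q = {}"
    proof (rule equals0I)
      fix z assume "z \<in> h ` {a..x} \<inter> h ` {x..b} \<inter> path_image q"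
      then have "z \<in> path_image q" "z = h x" using int[of z] by simp_all
      then show False using x(2) by simp
    qed
    ultimately show False using connected_closedD[of "path_image q", OF _ _ un cl] by blast
  qed
  with q show ?thesis using that by blast
qed

lemma Jordan_curve_based_at:
  assumes "Jordan_curve J" "p \<in> J"
  obtains g where "simple_path g" "pathfinish g = pathstart g" "path_image g = J" "g 0 = p" "g 1 = p"
proof -
  obtain g where g: "simple_path g" "pathfinish g = pathstart g" "path_image g = J"
    using assms by (auto simp: Jordan_curve_def)
  then obtain t where t: "t \<in> {0..1}" "g t = p" using assms(2) by (auto simp: path_image_def)
  show ?thesis
  proof (rule that)
    show "simple_path (shiftpath t g)" using g t by (intro simple_path_shiftpath) auto
    show "pathfinish (shiftpath t g) = pathstart (shiftpath t g)" using g(2) t(1) by (rule closed_shiftpath)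
    show "path_image (shiftpath t g) = J" using path_image_shiftpath[OF t(1) g(2)] g(3) by simp
    show "shiftpath t g 0 = p" using pathstart_shiftpath[of t g] t by (simp add: pathstart_def)
    show "shiftpath t g 1 = p" using pathfinish_shiftpath[of t g] t g(2) by (simp add: pathfinish_def)
  qed
qed

text \<open>The connected set is the curve without a short open arc around \<open>y\<close>, obtained from a
  parametrization that starts and ends at \<open>y\<close>.\<close>

lemma Jordan_curve_minus_nbhd:
  fixes J :: "'a::t2_space set"
  assumes J: "Jordan_curve J" and y: "y \<in> J" and O': "open O'" "y \<in> O'"
  shows "\<exists>C. closed C \<and> connected C \<and> C \<subseteq> J - {y} \<and> J - O' \<subseteq> C"
proof -
  obtain g where g: "simple_path g" "path_image g = J" "g 0 = y" "g 1 = y"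
    using Jordan_curve_based_at[OF J y] by metis
  have cont: "continuous_on {0..1} g" using g(1) by (simp add: simple_path_def path_def)
  have near: "\<exists>d>0. \<forall>t\<in>{0..1}. dist t s < d \<longrightarrow> g t \<in> O'" if s: "s \<in> {0..1}" "g s = y" for s
  proof -
    have "(g \<longlongrightarrow> g s) (at s within {0..1})" using cont s(1) by (simp add: continuous_on_def)
    then have "eventually (\<lambda>t. g t \<in> O') (at s within {0..1})"
      using O' s(2) by (auto dest: topological_tendstoD)
    then obtain d where "d > 0" "\<And>t. t \<in> {0..1} \<Longrightarrow> t \<noteq> s \<Longrightarrow> dist t s < d \<Longrightarrow> g t \<in> O'"
      unfolding eventually_at by blast
    then show ?thesis using O'(2) s(2) by metis
  qed
  obtain d0 where d0: "d0 > 0" "\<And>t. t \<in> {0..1} \<Longrightarrow> dist t 0 < d0 \<Longrightarrow> g t \<in> O'" using near[of 0] g(3) by auto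
  obtain d1 where d1: "d1 > 0" "\<And>t. t \<in> {0..1} \<Longrightarrow> dist t 1 < d1 \<Longrightarrow> g t \<in> O'" using near[of 1] g(4) by auto
  define d where "d = min (1/2) (min (d0/2) (d1/2))"
  have d: "0 < d" "d \<le> 1/2" "d < d0" "d < d1" using d0 d1 by (auto simp: d_def)
  define C where "C = g ` {d..1-d}"
  have sub: "{d..1-d} \<subseteq> {0..1}" using d by auto
  have "compact C" "connected C"
    unfolding C_def using continuous_on_subset[OF cont sub]
    by (auto intro: compact_continuous_image connected_continuous_image)
  moreover have "y \<notin> C"
  proof
    assume "y \<in> C"
    then obtain t where t: "d \<le> t" "t \<le> 1 - d" "g t = y" by (auto simp: C_def)
    then have "t = 0 \<or> t = 1"
      using g(1,3) d unfolding simple_path_def loop_free_def by (elim conjE ballE[of _ _ t] ballE[of _ _ 0]) auto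
    then show False using t d by auto
  qed
  moreover have "C \<subseteq> J" unfolding C_def g(2)[symmetric] path_image_def using sub by (rule image_mono)
  moreover have "J - O' \<subseteq> C"
  proof
    fix x assume x: "x \<in> J - O'"
    then obtain t where t: "t \<in> {0..1}" "x = g t" using g(2) by (auto simp: path_image_def)
    then have "\<not> t < d" "\<not> t > 1 - d" using d0(2)[OF t(1)] d1(2)[OF t(1)] x d by (auto simp: dist_real_def)
    then show "x \<in> C" using t by (auto simp: C_def)
  qed
  ultimately show ?thesis using compact_imp_closed by blast
qed

text \<open>Away from its ends a simple path is injective, and on the compact set of parameters of \<open>F\<close> it is
  therefore a homeomorphism onto \<open>F\<close>.\<close>

lemma connected_preimage_simple_path:
  fixes g :: "real \<Rightarrow> 'a::t2_space"
  assumes g: "simple_path g" and F: "closed F" "connected F" "F \<subseteq> path_image g" "g 0 \<notin> F" "g 1 \<notin> F"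
  shows "connected {t \<in> {0..1}. g t \<in> F}" "compact {t \<in> {0..1}. g t \<in> F}"
proof -
  let ?T = "{t \<in> {0..1}. g t \<in> F}"
  have cont: "continuous_on {0..1} g" using g by (simp add: simple_path_def path_def)
  have "closed ?T"
    using continuous_closed_preimage[OF cont closed_atLeastAtMost F(1)] by (simp add: vimage_def Int_def)
  moreover have T01: "?T \<subseteq> {0..1}" by auto
  ultimately show "compact ?T" using compact_Int_closed[OF compact_Icc[of 0 1], of ?T] by (simp add: Int_absorb1)
  moreover have "continuous_on ?T g" using continuous_on_subset[OF cont T01] .
  moreover have "g ` ?T = F" using F(3) by (auto simp: path_image_def)
  moreover have "?T \<subseteq> {0<..<1}" using F(4,5) by (auto simp: less_le)
  then have "inj_on g ?T" using simple_path_inj_on[OF g] by (rule inj_on_subset[rotated])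
  ultimately have "?T homeomorphic F" by (rule homeomorphic_compact)
  then show "connected ?T" using F(2) homeomorphic_connectedness by blast
qed

lemma simple_path_segment_arc:
  fixes g :: "real \<Rightarrow> 'a::topological_space"
  assumes g: "simple_path g" and st: "0 \<le> s" "s < t" "t \<le> 1" "0 < s \<or> t < 1"
  shows "\<exists>\<gamma>. arc \<gamma> \<and> path_image \<gamma> = g ` {s..t}"
proof -
  define l where "l x = (t - s) * x + s" for x :: real
  have lim: "l ` {0..1} = {s..t}"
    using image_affinity_atLeastAtMost[of "t - s" s 0 1] st by (simp add: l_def[abs_def])
  have sub: "{s..t} \<subseteq> {0..1}" using st by auto
  have "continuous_on {0..1} g" using g by (simp add: simple_path_def path_def)
  then have "continuous_on {s..t} g" using sub continuous_on_subset by blast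
  moreover have "continuous_on {0..1} l" unfolding l_def by (intro continuous_intros)
  ultimately have "path (g \<circ> l)" unfolding path_def using lim by (intro continuous_on_compose) auto
  moreover have "inj_on (g \<circ> l) {0..1}"
  proof (rule comp_inj_on)
    show "inj_on l {0..1}" using st by (auto simp: l_def inj_on_def)
    have "inj_on g {s..t}"
    proof (rule inj_onI)
      fix x y assume "x \<in> {s..t}" "y \<in> {s..t}" "g x = g y"
      then show "x = y" using g st sub unfolding simple_path_def loop_free_def by (smt (verit) atLeastAtMost_iff)
    qed
    then show "inj_on g (l ` {0..1})" by (simp add: lim)
  qed
  moreover have "path_image (g \<circ> l) = g ` {s..t}" using lim by (metis image_comp path_image_def)
  ultimately show ?thesis by (auto simp: arc_def)
qed

text \<open>Cutting the curve open at a point outside \<open>F\<close> turns \<open>F\<close> into the image of a parameter interval.\<close>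

lemma connected_subset_Jordan_curve_contains_arc:
  fixes F :: "'a::t2_space set"
  assumes J: "Jordan_curve J" and F: "closed F" "connected F" "F \<subseteq> J" and xy: "x \<in> F" "y \<in> F" "x \<noteq> y"
  shows "\<exists>\<gamma>. arc \<gamma> \<and> path_image \<gamma> \<subseteq> F"
proof (cases "F = J")
  case True
  obtain g where g: "simple_path g" "path_image g = J" using J by (auto simp: Jordan_curve_def)
  obtain \<gamma> where "arc \<gamma>" "path_image \<gamma> = g ` {0..1/2}" using simple_path_segment_arc[OF g(1), of 0 "1/2"] by auto
  moreover have "g ` {0..1/2} \<subseteq> J" unfolding g(2)[symmetric] path_image_def by (rule image_mono) auto
  ultimately show ?thesis using True by auto
next
  case False
  then obtain p where p: "p \<in> J" "p \<notin> F" using F(3) by auto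
  obtain g where g: "simple_path g" "path_image g = J" "g 0 = p" "g 1 = p"
    using Jordan_curve_based_at[OF J p(1)] by metis
  let ?T = "{t \<in> {0..1}. g t \<in> F}"
  have T: "connected ?T" using connected_preimage_simple_path(1)[OF g(1) F(1,2)] F(3) g p by auto
  have "F \<subseteq> g ` {0..1}" using F(3) g(2) by (simp add: path_image_def)
  then have "x \<in> g ` {0..1}" "y \<in> g ` {0..1}" using xy by auto
  then obtain s' t' where st': "s' \<in> {0..1}" "t' \<in> {0..1}" "x = g s'" "y = g t'" by (elim imageE)
  then have "s' \<in> ?T" "t' \<in> ?T" using xy by simp_all
  moreover have "s' < t' \<or> t' < s'" using st'(3,4) xy(3) neq_iff by blast
  ultimately obtain s t where st: "s \<in> ?T" "t \<in> ?T" "s < t" by (elim disjE)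
  then have sub: "{s..t} \<subseteq> ?T" by (intro connected_contains_Icc[OF T])
  moreover have "0 < s" using st(1) p(2) g(3) by (auto simp: less_le)
  ultimately obtain \<gamma> where "arc \<gamma>" "path_image \<gamma> = g ` {s..t}"
    using simple_path_segment_arc[OF g(1), of s t] st by auto
  moreover have "g ` {s..t} \<subseteq> F" using sub by auto
  ultimately show ?thesis by auto
qed

text \<open>The fibre over \<open>y0\<close> is \<open>g ` {s..t}\<close>, an arc of the curve or a single point. Starting the loop at \<open>g t\<close> and stopping at
  \<open>g s\<close>, after parameter time \<open>m\<close>, leaves a map \<open>h\<close> on \<open>{0..m}\<close> that takes the value \<open>y0\<close> only at the two ends and
  has intervals as its other fibres. Each half of it has an arc as its image, and the two arcs
  have only their ends in common.\<close>

theorem monotone_image_Jordan_curve: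
  fixes f :: "'a::t2_space \<Rightarrow> ext_complex"
  assumes P: "Jordan_curve P" and cont: "continuous_on P f"
    and fib: "\<And>y. connected {x \<in> P. f x = y}" and ne: "x\<^sub>1 \<in> P" "x\<^sub>2 \<in> P" "f x\<^sub>1 \<noteq> f x\<^sub>2"
  shows "Jordan_curve (f ` P)"
proof -
  \<comment> \<open>The loop starts at \<open>x\<^sub>2\<close>, outside the fibre over \<open>y0\<close>, so that this fibre is an interval of parameters.\<close>
  define y0 where "y0 = f x\<^sub>1"
  have clP: "closed P"
    using P compact_simple_path_image compact_imp_closed unfolding Jordan_curve_def by metis
  have clfib: "closed {x \<in> P. f x = y}" for y
    using continuous_closed_preimage[OF cont clP closed_singleton[of y]] by (simp add: vimage_def Int_def)
  obtain g where g: "simple_path g" "pathfinish g = pathstart g" "path_image g = P" "g 0 = x\<^sub>2" "g 1 = x\<^sub>2"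
    using Jordan_curve_based_at[OF P ne(2)] by metis
  let ?S = "{t \<in> {0..1}. g t \<in> {x \<in> P. f x = y0}}"
  have "{x \<in> P. f x = y0} \<subseteq> path_image g" "g 0 \<notin> {x \<in> P. f x = y0}" "g 1 \<notin> {x \<in> P. f x = y0}"
    using g ne by (auto simp: y0_def)
  then have "connected ?S" "compact ?S"
    using connected_preimage_simple_path[OF g(1) clfib fib] by blast+
  then obtain s t where S: "?S = {s..t}" using connected_compact_interval_1[of ?S] by (auto simp: cbox_interval)
  have inP: "g x \<in> P" if "x \<in> {0..1}" for x using that g(3) by (auto simp: path_image_def)
  have fg: "f (g x) = y0 \<longleftrightarrow> x \<in> {s..t}" if "x \<in> {0..1}" for x using S inP[OF that] that by blast
  obtain t1 where "t1 \<in> {0..1}" "g t1 = x\<^sub>1" using ne(1) g(3) by (auto simp: path_image_def)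
  then have "t1 \<in> {s..t}" using fg[of t1] by (simp add: y0_def)
  then have st1: "s \<le> t" by auto
  then have "s \<in> ?S" "t \<in> ?S" using S by auto
  moreover have "0 \<notin> ?S" "1 \<notin> ?S" using g ne by (auto simp: y0_def)
  ultimately have st: "0 < s" "s \<le> t" "t < 1" using st1 by (auto simp: less_le)
  define g' where "g' = shiftpath t g"
  define m where "m = 1 - (t - s)"
  have m: "0 < m" "m \<le> 1" using st by (auto simp: m_def)
  have g': "simple_path g'" "path_image g' = P"
    using g st path_image_shiftpath[of t g] by (auto simp: g'_def intro!: simple_path_shiftpath)
  have g'eq: "g' x = (if t + x \<le> 1 then g (t + x) else g (t + x - 1))" for x by (simp add: g'_def shiftpath_def)
  have cont': "continuous_on {0..1} (f \<circ> g')"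
    using g' cont by (intro continuous_on_compose) (auto simp: simple_path_def path_def path_image_def)
  define h where "h = f \<circ> g'"
  have conth: "continuous_on {a..b} h" if "0 \<le> a" "b \<le> 1" for a b
    using that unfolding h_def by (intro continuous_on_subset[OF cont']) auto
  have h0: "h 0 = y0" "h 1 = y0" using fg[of t] st by (auto simp: h_def g'eq)
  have hy: "h x = y0" if "m \<le> x" "x \<le> 1" for x
  proof (cases "t + x \<le> 1")
    case True
    then have "x \<le> 1 - t" "m \<le> 1 - t" using that by auto
    then show ?thesis using st by (simp add: m_def)
  next
    case False
    then show ?thesis using that st fg[of "t + x - 1"] by (auto simp: h_def g'eq m_def)
  qed
  have hny: "h x \<noteq> y0" if "0 < x" "x < m" for x
    using that st fg[of "t + x"] fg[of "t + x - 1"] by (auto simp: h_def g'eq m_def)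
  have him: "h ` {0..m} = f ` P"
  proof
    show "h ` {0..m} \<subseteq> f ` P" using g'(2) m by (auto simp: h_def path_image_def)
    show "f ` P \<subseteq> h ` {0..m}"
    proof clarify
      fix z assume "z \<in> P"
      then obtain x where x: "x \<in> {0..1}" "z = g' x" using g'(2) by (auto simp: path_image_def)
      show "f z \<in> h ` {0..m}"
      proof (cases "x \<le> m")
        case True
        then show ?thesis using x by (auto simp: h_def)
      next
        case False
        then have "f z = h 0" using hy[of x] x h0 by (simp add: h_def)
        then show ?thesis using m by auto
      qed
    qed
  qed
  have fibh: "connected {x \<in> {0..m}. h x = y}" if y: "y \<noteq> y0" for y
  proof -
    have "{x \<in> {0..m}. h x = y} = {x \<in> {0..1}. g' x \<in> {x \<in> P. f x = y}}"
    proof (rule Collect_cong)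
      fix x
      have "x \<le> m" if "x \<in> {0..1}" "h x = y" using that hy[of x] y by fastforce
      moreover have "g' x \<in> P" if "x \<in> {0..1}" using that g'(2) by (auto simp: path_image_def)
      ultimately show "x \<in> {0..m} \<and> h x = y \<longleftrightarrow> x \<in> {0..1} \<and> g' x \<in> {x \<in> P. f x = y}"
        using m by (auto simp: h_def)
    qed
    moreover have "connected {x \<in> {0..1}. g' x \<in> {x \<in> P. f x = y}}"
    proof (rule connected_preimage_simple_path(1)[OF g'(1) clfib fib])
      show "{x \<in> P. f x = y} \<subseteq> path_image g'" using g'(2) by auto
      show "g' 0 \<notin> {x \<in> P. f x = y}" "g' 1 \<notin> {x \<in> P. f x = y}" using y h0 by (auto simp: h_def)
    qed
    ultimately show ?thesis by simp
  qed
  \<comment> \<open>Any interior parameter would do as the point where the two arcs meet.\<close>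
  define c where "c = m / 2"
  have c: "0 < c" "c < m" using m by (auto simp: c_def)
  have hc: "h c \<noteq> y0" using hny c by simp
  have fibsub: "connected {x \<in> {a..b}. h x = y}" if "0 \<le> a" "b \<le> m" "y \<noteq> y0" for a b y
  proof -
    have "is_interval {x \<in> {0..m}. h x = y}" using fibh[OF that(3)] by (simp add: is_interval_connected_1)
    then have "is_interval ({a..b} \<inter> {x \<in> {0..m}. h x = y})" by (intro is_interval_Int is_interval_cc)
    moreover have "{a..b} \<inter> {x \<in> {0..m}. h x = y} = {x \<in> {a..b}. h x = y}" using that by auto
    ultimately show ?thesis by (simp add: is_interval_connected_1)
  qed
  have "x = 0" if "x \<in> {0..c}" "h x = y0" for x using hny[of x] that c by fastforce
  then have "{x \<in> {0..c}. h x = y0} = {0}" using c h0 by auto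
  then have fib1: "connected {x \<in> {0..c}. h x = y}" for y using fibsub[of 0 c y] c by (cases "y = y0") auto
  have "x = m" if "x \<in> {c..m}" "h x = y0" for x using hny[of x] that c by fastforce
  then have "{x \<in> {c..m}. h x = y0} = {m}" using c hy[of m] m by auto
  then have fib2: "connected {x \<in> {c..m}. h x = y}" for y using fibsub[of c m y] c by (cases "y = y0") auto
  obtain \<gamma>1 where \<gamma>1: "arc \<gamma>1" "path_image \<gamma>1 = h ` {0..c}" "pathstart \<gamma>1 = y0" "pathfinish \<gamma>1 = h c"
    by (rule monotone_image_arc[of 0 c h]) (use conth[of 0 c] c m hc fib1 h0 in auto)
  have hm: "h m = y0" using hy m by simp
  obtain \<gamma>2 where \<gamma>2: "arc \<gamma>2" "path_image \<gamma>2 = h ` {c..m}" "pathstart \<gamma>2 = h c" "pathfinish \<gamma>2 = y0"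
    by (rule monotone_image_arc[of c m h]) (use conth[of c m] c m hc fib2 hm in auto)
  have "path_image \<gamma>1 \<inter> path_image \<gamma>2 \<subseteq> {y0, h c}"
  proof
    fix y assume "y \<in> path_image \<gamma>1 \<inter> path_image \<gamma>2"
    then obtain a b where ab: "a \<in> {0..c}" "b \<in> {c..m}" "h a = y" "h b = y" using \<gamma>1(2) \<gamma>2(2) by auto
    show "y \<in> {y0, h c}"
    proof (rule ccontr)
      assume y: "y \<notin> {y0, h c}"
      then have "y \<noteq> y0" by simp
      moreover have "a \<in> {x \<in> {0..m}. h x = y}" "b \<in> {x \<in> {0..m}. h x = y}" using ab c by auto
      ultimately have "{a..b} \<subseteq> {x \<in> {0..m}. h x = y}" by (intro connected_contains_Icc[OF fibh])
      moreover have "c \<in> {a..b}" using ab by simp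
      ultimately show False using y by blast
    qed
  qed
  then have "simple_path (\<gamma>1 +++ \<gamma>2)"
    using \<gamma>1 \<gamma>2 by (intro simple_path_join_loop) auto
  moreover have "pathfinish (\<gamma>1 +++ \<gamma>2) = pathstart (\<gamma>1 +++ \<gamma>2)" using \<gamma>1 \<gamma>2 by simp
  moreover have "path_image (\<gamma>1 +++ \<gamma>2) = f ` P"
  proof -
    have "path_image (\<gamma>1 +++ \<gamma>2) = h ` {0..c} \<union> h ` {c..m}" using \<gamma>1 \<gamma>2 by (simp add: path_image_join)
    also have "\<dots> = h ` {0..m}" using c ivl_disj_un_two_touch(4)[of 0 c m] by (simp add: image_Un[symmetric])
    finally show ?thesis using him by simp
  qed
  ultimately show ?thesis unfolding Jordan_curve_def by blast
qed

section \<open>Monotone extensions\<close>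

context boundary_extension
begin

lemma fibre_interior:
  assumes y: "y \<in> \<Omega>" shows "{x \<in> closure U. \<Phi> x = y} = {\<psi> y}"
proof
  show "{x \<in> closure U. \<Phi> x = y} \<subseteq> {\<psi> y}"
  proof clarify
    fix x assume x: "x \<in> closure U" "y = \<Phi> x"
    then have "x \<notin> frontier U" using y frontier_maps open_\<Omega> by (auto simp: frontier_def interior_open)
    then have "x \<in> U" using x(1) open_U by (simp add: frontier_def interior_open)
    then show "x = \<psi> (\<Phi> x)" using eq hom by (auto simp: homeomorphism_def)
  qed
  have "\<psi> y \<in> U" "\<phi> (\<psi> y) = y" using hom y by (auto simp: homeomorphism_def)
  then show "{\<psi> y} \<subseteq> {x \<in> closure U. \<Phi> x = y}" using eq closure_subset[of U] by auto
qed

lemma generalized_Jordan_of_connected_fibres: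
  assumes U: "generalized_Jordan_domain U"
    and fib: "\<And>y. y \<in> frontier \<Omega> \<Longrightarrow> connected {x \<in> closure U. \<Phi> x = y}"
  shows "generalized_Jordan_domain \<Omega>"
  unfolding generalized_Jordan_domain_iff
proof (intro conjI ballI)
  show "is_domain \<Omega>" by (rule dom_\<Omega>)
  show "Peano_compactum (frontier \<Omega>)"
    using U by (intro Peano_compactum_image) (simp add: generalized_Jordan_domain_iff)
  fix Q assume Q: "Q \<in> components (frontier \<Omega>)"
  define P where "P = {x \<in> closure U. \<Phi> x \<in> Q}"
  have P: "P \<in> components (frontier U)" "\<Phi> ` P = Q" using component_fibre[OF Q] by (simp_all add: P_def)
  show "(\<exists>p. Q = {p}) \<or> Jordan_curve Q"
  proof (cases "\<exists>p. Q = {p}")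
    case False
    have "Q \<noteq> {}" by (rule in_components_nonempty[OF Q])
    then obtain y1 where y1: "y1 \<in> Q" by blast
    then obtain y2 where y2: "y2 \<in> Q" "y2 \<noteq> y1" using False by blast
    obtain x1 x2 where x: "x1 \<in> P" "x2 \<in> P" "\<Phi> x1 = y1" "\<Phi> x2 = y2" using y1 y2(1) P(2) by blast
    have "\<nexists>p. P = {p}" using x y2(2) by auto
    then have JP: "Jordan_curve P" using U P(1) by (auto simp: generalized_Jordan_domain_iff)
    have "Jordan_curve (\<Phi> ` P)"
    proof (rule monotone_image_Jordan_curve[OF JP _ _ x(1,2)])
      show "continuous_on P \<Phi>" using cont by (rule continuous_on_subset) (auto simp: P_def)
      show "\<Phi> x1 \<noteq> \<Phi> x2" using x y2 by simp
      fix y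
      show "connected {x \<in> P. \<Phi> x = y}"
      proof (cases "y \<in> Q")
        case True
        then have "{x \<in> P. \<Phi> x = y} = {x \<in> closure U. \<Phi> x = y}" by (auto simp: P_def)
        then show ?thesis using fib[of y] True in_components_subset[OF Q] by auto
      next
        case False
        then have "{x \<in> P. \<Phi> x = y} = {}" by (auto simp: P_def)
        then show ?thesis by (simp only: connected_empty)
      qed
    qed
    then show ?thesis using P(2) by simp
  qed simp
qed

text \<open>Over a boundary point \<open>y\<close>, the boundary component of \<open>y\<close> is a point or a Jordan curve, neither of
  which is cut apart by removing \<open>y\<close>; so \<open>\<Omega>\<close> is locally connected at \<open>y\<close> and the fibre is connected.\<close>

lemma connected_fibres_of_generalized_Jordan:
  assumes \<Omega>: "generalized_Jordan_domain \<Omega>"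
  shows "connected {x \<in> closure U. \<Phi> x = y}"
proof (cases "y \<in> frontier \<Omega>")
  case True
  define X0 where "X0 = connected_component_set (frontier \<Omega>) y"
  have X0: "X0 \<in> components (frontier \<Omega>)" "y \<in> X0"
    using True by (auto simp: X0_def componentsI connected_component_refl)
  have "connected_near \<Omega> {y}"
  proof (rule connected_near_point[OF dom_\<Omega> _ X0])
    show "finite {K \<in> components (frontier \<Omega>). diameter K > c}" if "c > 0" for c
      using \<Omega> that by (simp add: generalized_Jordan_domain_iff Peano_compactum_def)
    fix O' assume O': "open O'" "y \<in> O'"
    have "(\<exists>p. X0 = {p}) \<or> Jordan_curve X0" using \<Omega> X0(1) by (simp add: generalized_Jordan_domain_iff)
    then show "\<exists>C. closed C \<and> connected C \<and> C \<subseteq> X0 - {y} \<and> X0 - O' \<subseteq> C"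
    proof
      assume "\<exists>p. X0 = {p}"
      then show ?thesis using X0(2) O' by (intro exI[of _ "{}"]) auto
    qed (rule Jordan_curve_minus_nbhd[OF _ X0(2) O'])
  qed
  then have "connected {x \<in> closure U. \<Phi> x \<in> {y}}" using True by (intro connected_fibre) auto
  then show ?thesis by simp
next
  case False
  show ?thesis
  proof (cases "y \<in> \<Omega>")
    case True
    then show ?thesis by (simp add: fibre_interior)
  next
    case y: False
    then have "y \<notin> closure \<Omega>" using False open_\<Omega> by (simp add: frontier_def interior_open)
    then have "{x \<in> closure U. \<Phi> x = y} = {}" using maps by auto
    then show ?thesis by (simp only: connected_empty)
  qed
qed

lemma monotone_iff_generalized_Jordan:
  assumes "generalized_Jordan_domain U"
  shows "monotone_map (top_of_set (closure U)) (top_of_set (closure \<Omega>)) \<Phi> \<longleftrightarrow> generalized_Jordan_domain \<Omega>"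
proof
  assume "monotone_map (top_of_set (closure U)) (top_of_set (closure \<Omega>)) \<Phi>"
  then have "connected {x \<in> closure U. \<Phi> x = y}" for y
    by (simp add: monotone_map connectedin_subtopology)
  then show "generalized_Jordan_domain \<Omega>"
    using assms by (intro generalized_Jordan_of_connected_fibres)
next
  assume "generalized_Jordan_domain \<Omega>"
  then show "monotone_map (top_of_set (closure U)) (top_of_set (closure \<Omega>)) \<Phi>"
    using maps connected_fibres_of_generalized_Jordan
    by (auto simp: monotone_map connectedin_subtopology)
qed

text \<open>The fibres are connected, and a fibre with two points would lie on a Jordan curve of
  \<open>frontier U\<close> and contain an arc that is collapsed to a boundary point.\<close>

lemma homeomorphism_of_no_collapsed_arc:
  assumes U: "generalized_Jordan_domain U" and \<Omega>: "generalized_Jordan_domain \<Omega>"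
    and no_arc: "\<not> (\<exists>\<gamma>. arc \<gamma> \<and> path_image \<gamma> \<subseteq> frontier U \<and> diameter (path_image \<gamma>) > 0 \<and>
                  (\<exists>p \<in> frontier \<Omega>. \<Phi> ` path_image \<gamma> = {p}))"
  shows "\<exists>\<Psi>. homeomorphism (closure U) (closure \<Omega>) \<Phi> \<Psi>"
proof -
  have "inj_on \<Phi> (closure U)"
  proof (rule inj_onI, rule ccontr)
    fix a b assume ab: "a \<in> closure U" "b \<in> closure U" "\<Phi> a = \<Phi> b" "a \<noteq> b"
    define y where "y = \<Phi> a"
    define F where "F = {x \<in> closure U. \<Phi> x = y}"
    have abF: "a \<in> F" "b \<in> F" using ab by (auto simp: F_def y_def)
    have "y \<notin> \<Omega>" using fibre_interior[of y] abF ab(4) unfolding F_def[symmetric] by blast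
    then have y: "y \<in> frontier \<Omega>"
      using maps ab(1) open_\<Omega> by (auto simp: frontier_def interior_open y_def)
    have F: "connected F" unfolding F_def by (rule connected_fibres_of_generalized_Jordan[OF \<Omega>])
    have clF: "closed F"
      using continuous_closed_preimage[OF cont closed_closure closed_singleton[of y]]
      by (simp add: F_def vimage_def Int_def)
    have FU: "F \<subseteq> frontier U" using frontier_preimage y by (auto simp: F_def)
    then obtain P where P: "P \<in> components (frontier U)" "F \<subseteq> P"
      using exists_component_superset[OF FU _ F] abF by blast
    have "\<nexists>p. P = {p}" using abF ab(4) P(2) by auto
    then have "Jordan_curve P" using U P(1) by (auto simp: generalized_Jordan_domain_iff)
    then obtain \<gamma> where \<gamma>: "arc \<gamma>" "path_image \<gamma> \<subseteq> F"
      using connected_subset_Jordan_curve_contains_arc[OF _ clF F P(2) abF ab(4)] by blast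
    have "pathstart \<gamma> \<noteq> pathfinish \<gamma>" using \<gamma>(1) by (rule arc_distinct_ends[THEN not_sym])
    then have "0 < dist (pathstart \<gamma>) (pathfinish \<gamma>)" by simp
    also have "\<dots> \<le> diameter (path_image \<gamma>)"
      by (rule diameter_bounded_bound[OF bounded_ext pathstart_in_path_image pathfinish_in_path_image])
    finally have "0 < diameter (path_image \<gamma>)" .
    moreover have "\<Phi> ` path_image \<gamma> = {y}"
      using \<gamma>(2) pathstart_in_path_image[of \<gamma>] by (auto simp: F_def)
    ultimately show False using no_arc \<gamma> FU y by blast
  qed
  then show ?thesis
    using cont onto by (intro homeomorphism_compact) (auto simp: compact_iff_closed_ext)
qed

end

theorem theorem3p1:
  fixes U \<Omega> :: "ext_complex set" and \<phi> :: "ext_complex \<Rightarrow> ext_complex"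
  assumes "generalized_Jordan_domain U"
    and "is_domain \<Omega>"
    and "\<exists>\<psi>. homeomorphism U \<Omega> \<phi> \<psi>"
  shows "((\<exists>\<Phi>. continuous_extension U \<Omega> \<phi> \<Phi>) \<longleftrightarrow>
            Peano_compactum (frontier \<Omega>) \<and>
            (\<forall>z\<^sub>0 \<in> frontier U.
               Liminf (at_right 0) (\<lambda>r. ereal (oscillation \<phi> U z\<^sub>0 r)) = 0)) \<and>
         (\<forall>\<Phi>. continuous_extension U \<Omega> \<phi> \<Phi> \<longrightarrow>
            (monotone_map (top_of_set (closure U)) (top_of_set (closure \<Omega>)) \<Phi> \<longleftrightarrow>
               generalized_Jordan_domain \<Omega>) \<and>
            (generalized_Jordan_domain \<Omega> \<and>
             \<not> (\<exists>\<gamma>. arc \<gamma> \<and> path_image \<gamma> \<subseteq> frontier U \<and> diameter (path_image \<gamma>) > 0 \<and>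
                  (\<exists>p \<in> frontier \<Omega>. \<Phi> ` path_image \<gamma> = {p})) \<longrightarrow>
             (\<exists>\<Psi>. homeomorphism (closure U) (closure \<Omega>) \<Phi> \<Psi>)))"
proof -
  obtain \<psi> where \<psi>: "homeomorphism U \<Omega> \<phi> \<psi>" using assms(3) by blast
  have U: "is_domain U" "Peano_compactum (frontier U)"
    using assms(1) by (auto simp: generalized_Jordan_domain_iff)
  have ext: "boundary_extension U \<Omega> \<phi> \<psi> \<Phi>" if "continuous_extension U \<Omega> \<phi> \<Phi>" for \<Phi>
    using U(1) assms(2) \<psi> that by (rule boundary_extension.intro)
  have "Peano_compactum (frontier \<Omega>) \<and>
      (\<forall>z\<^sub>0 \<in> frontier U. Liminf (at_right 0) (\<lambda>r. ereal (oscillation \<phi> U z\<^sub>0 r)) = 0)"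
    if "continuous_extension U \<Omega> \<phi> \<Phi>" for \<Phi>
    using boundary_extension.Peano_compactum_image[OF ext[OF that] U(2)]
      boundary_extension.Liminf_oscillation[OF ext[OF that]] by blast
  moreover have "\<exists>\<Phi>. continuous_extension U \<Omega> \<phi> \<Phi>"
    if "Peano_compactum (frontier \<Omega>) \<and>
      (\<forall>z\<^sub>0 \<in> frontier U. Liminf (at_right 0) (\<lambda>r. ereal (oscillation \<phi> U z\<^sub>0 r)) = 0)"
    using extension_of_small_oscillation[OF U(1) assms(2) \<psi>] that by blast
  moreover note boundary_extension.monotone_iff_generalized_Jordan[OF ext assms(1)]
    boundary_extension.homeomorphism_of_no_collapsed_arc[OF ext assms(1)]
  ultimately show ?thesis by blast
qed

end
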